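(* Let $G$ be any partially ordered group and $\mathsf V$ any variety of representable $\ell$-groups. The following hold. (1) The set $\mathscr{B}_{\mathsf V}(G)$ with the subspace topology induced from $\mathscr{P}_{\mathsf V}(G)$ is a generalised spectral space. (2) The map $\beta$ given by $\beta(C)=\bigcap_{t\in G}t^{-1}Ct$ for $C\in\mathscr{P}_{\mathsf V}(G)$ is a (well-defined) interior operator on $\mathscr{P}_{\mathsf V}(G)$, partially ordered by inclusion, and $\mathscr{B}_{\mathsf V}(G)$ consists precisely of the open elements of $\beta$. Moreover, $\beta\colon\mathscr{P}_{\mathsf V}(G)\to\mathscr{B}_{\mathsf V}(G)$ is a continuous retraction.
   Context: A partially ordered group is a group $G$ (identity $\mathrm{e}$) with a partial order such that $a\le b$ implies $sat\le sbt$; $G^+=\{a\mid a\ge \mathrm{e}\}$. An $\ell$-group is a partially ordered group whose order is a lattice; it is representable if it is a subdirect product of totally ordered groups. An $\ell$-subgroup is a sublattice subgroup; a variety of representable $\ell$-groups is an equationally definable class of $\ell$-groups all of whose members are representable. A right pre-order on $G$ is a reflexive, transitive, total relation $\preceq$ on $G$, with $\preceq\ne G\times G$, extending the partial order of $G$ and such that $a\preceq b\Rightarrow at\preceq bt$. It is identified with its pre-cone $C=\{a\mid \mathrm{e}\preceq a\}$; pre-cones are exactly the proper submonoids $C\subsetneq G$ with $G=C\cup C^{-1}$ and $G^+\subseteq C$, and $a\preceq_C b$ iff $ba^{-1}\in C$. It is a pre-order on $G$ if it is also left invariant, equivalently if $C$ is closed under conjugation. Put $a\equiv_C b$ iff $a\preceq_C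 b$ and $b\preceq_C a$; $\Omega_C=G/{\equiv_C}$ is a chain with $[a]\le_C[b]$ iff $a\preceq_C b$. $\mathrm{Aut}\,\Omega_C$ is the $\ell$-group of order-preserving bijections of $\Omega_C$, where $f\cdot g$ means "$g$ after $f$" and lattice operations are pointwise. With $R_C(a)\colon[b]\mapsto[ba]$, $H_C$ is the $\ell$-subgroup of $\mathrm{Aut}\,\Omega_C$ generated by $R_C[G]$. $\mathscr{P}_{\mathsf V}(G)$ is the set of right pre-orders (pre-cones) $C$ on $G$ with $H_C\in\mathsf V$, with the smallest topology containing all sets $\{C\in\mathscr{P}_{\mathsf V}(G)\mid a\in C,\ a^{-1}\notin C\}$, $a\in G$; $\mathscr{B}_{\mathsf V}(G)$ is its subset of pre-orders. A generalised spectral space is a sober space (every nonempty irreducible closed set is the closure of a unique point) whose compact open subsets form a base closed under finite (nonempty) intersections; it need not be compact. An interior operator on a poset $S$ is a map $\iota\colon S\to S$ that is contracting ($\iota(x)\le x$), monotone and idempotent; its fixed points are its open elements. *)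

theory Defs
  imports
    "HOL-Algebra.Lattice"
    "HOL-Algebra.Bij"
    "HOL-Algebra.Coset"
    "HOL-Algebra.Product_Groups"
    "HOL-Analysis.Abstract_Topology"
begin

record 'a ogroup = "'a monoid" +
  leq :: "['a, 'a] \<Rightarrow> bool" (infixl \<open>\<preceq>\<index>\<close> 50)

definition ord_of :: "('a, 'b) ogroup_scheme \<Rightarrow> 'a gorder" where
  "ord_of G = \<lparr>carrier = carrier G, eq = (=), le = leq G\<rparr>"

locale po_group = group G + partial_order "ord_of G"
  for G :: "('a, 'b) ogroup_scheme" (structure) +
  assumes translation_invariant:
    "\<lbrakk>a \<in> carrier G; b \<in> carrier G; s \<in> carrier G; t \<in> carrier G; a \<preceq> b\<rbrakk>
      \<Longrightarrow> s \<otimes> a \<otimes> t \<preceq> s \<otimes> b \<otimes> t"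

locale lgroup = po_group G + lattice "ord_of G"
  for G :: "('a, 'b) ogroup_scheme" (structure)

locale totally_ordered_group = po_group G + total_order "ord_of G"
  for G :: "('a, 'b) ogroup_scheme" (structure)

definition ljoin :: "('a, 'b) ogroup_scheme \<Rightarrow> 'a \<Rightarrow> 'a \<Rightarrow> 'a" where
  "ljoin L x y = x \<squnion>\<^bsub>ord_of L\<^esub> y"

definition lmeet :: "('a, 'b) ogroup_scheme \<Rightarrow> 'a \<Rightarrow> 'a \<Rightarrow> 'a" where
  "lmeet L x y = x \<sqinter>\<^bsub>ord_of L\<^esub> y"

definition lsubgroup :: "'a set \<Rightarrow> ('a, 'b) ogroup_scheme \<Rightarrow> bool" where
  "lsubgroup H L \<longleftrightarrow>
     subgroup H L \<and> (\<forall>x\<in>H. \<forall>y\<in>H. ljoin L x y \<in> H \<and> lmeet L x y \<in> H)"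

definition lsubgroup_generated :: "('a, 'b) ogroup_scheme \<Rightarrow> 'a set \<Rightarrow> 'a set" where
  "lsubgroup_generated L S = \<Inter>{H. lsubgroup H L \<and> S \<subseteq> H}"

definition lhom :: "('a, 'c) ogroup_scheme \<Rightarrow> ('b, 'd) ogroup_scheme \<Rightarrow> ('a \<Rightarrow> 'b) set" where
  "lhom L M = {h \<in> hom L M. \<forall>x\<in>carrier L. \<forall>y\<in>carrier L.
     h (ljoin L x y) = ljoin M (h x) (h y) \<and> h (lmeet L x y) = lmeet M (h x) (h y)}"

definition product_ogroup :: "'i set \<Rightarrow> ('i \<Rightarrow> 'a ogroup) \<Rightarrow> ('i \<Rightarrow> 'a) ogroup" where
  "product_ogroup I T =
     \<lparr>carrier = carrier (product_group I T),
      mult = mult (product_group I T),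
      one = one (product_group I T),
      leq = (\<lambda>x y. \<forall>i\<in>I. x i \<preceq>\<^bsub>T i\<^esub> y i)\<rparr>"

text \<open>The factors of a subdirect product are quotients of \<open>L\<close>, and factors with the same
  kernel may be identified; so, up to isomorphism, it is no restriction that both the factors
  and the index set live in the type of subsets of \<open>L\<close> (cosets and kernels).\<close>

definition representable :: "'a ogroup \<Rightarrow> bool" where
  "representable L \<longleftrightarrow> lgroup L \<and>
     (\<exists>(I :: 'a set set) (T :: 'a set \<Rightarrow> 'a set ogroup) h.
        (\<forall>i\<in>I. totally_ordered_group (T i)) \<and>
        h \<in> lhom L (product_ogroup I T) \<and>
        inj_on h (carrier L) \<and>
        (\<forall>i\<in>I. (\<lambda>x. h x i) ` carrier L = carrier (T i)))"

datatype lterm =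
    Var nat
  | One
  | Inv lterm
  | Mult lterm lterm
  | Join lterm lterm
  | Meet lterm lterm

primrec lterm_val :: "('a, 'b) ogroup_scheme \<Rightarrow> (nat \<Rightarrow> 'a) \<Rightarrow> lterm \<Rightarrow> 'a" where
  "lterm_val L \<rho> (Var n) = \<rho> n"
| "lterm_val L \<rho> One = \<one>\<^bsub>L\<^esub>"
| "lterm_val L \<rho> (Inv s) = inv\<^bsub>L\<^esub> (lterm_val L \<rho> s)"
| "lterm_val L \<rho> (Mult s t) = lterm_val L \<rho> s \<otimes>\<^bsub>L\<^esub> lterm_val L \<rho> t"
| "lterm_val L \<rho> (Join s t) = ljoin L (lterm_val L \<rho> s) (lterm_val L \<rho> t)"
| "lterm_val L \<rho> (Meet s t) = lmeet L (lterm_val L \<rho> s) (lterm_val L \<rho> t)"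

text \<open>A variety is given by a set of defining equations, so that membership makes sense for
  lattice-groups over every type.\<close>

definition in_variety :: "('a, 'b) ogroup_scheme \<Rightarrow> (lterm \<times> lterm) set \<Rightarrow> bool" where
  "in_variety L V \<longleftrightarrow> lgroup L \<and>
     (\<forall>(s, t)\<in>V. \<forall>\<rho>. range \<rho> \<subseteq> carrier L \<longrightarrow> lterm_val L \<rho> s = lterm_val L \<rho> t)"

text \<open>A formula cannot quantify over the members of \<open>V\<close> on all types at once.
  Countable members, which up to isomorphism live on \<^typ>\<open>nat\<close>, suffice: representability
  is defined by an equation in two variables, so it passes from the two-generated members
  of \<open>V\<close> to all of them.  As a hypothesis, the condition on countable members is in any case
  implied by the condition on all members.\<close>

definition representable_variety :: "(lterm \<times> lterm) set \<Rightarrow> bool" where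
  "representable_variety V \<longleftrightarrow> (\<forall>L :: nat ogroup. in_variety L V \<longrightarrow> representable L)"

definition right_preorder :: "'a ogroup \<Rightarrow> 'a rel \<Rightarrow> bool" where
  "right_preorder G r \<longleftrightarrow>
     r \<subseteq> carrier G \<times> carrier G \<and> refl_on (carrier G) r \<and> trans r \<and> total_on (carrier G) r \<and>
     r \<noteq> carrier G \<times> carrier G \<and>
     (\<forall>a\<in>carrier G. \<forall>b\<in>carrier G. a \<preceq>\<^bsub>G\<^esub> b \<longrightarrow> (a, b) \<in> r) \<and>
     (\<forall>a b. \<forall>t\<in>carrier G. (a, b) \<in> r \<longrightarrow> (a \<otimes>\<^bsub>G\<^esub> t, b \<otimes>\<^bsub>G\<^esub> t) \<in> r)"

definition preorder :: "'a ogroup \<Rightarrow> 'a rel \<Rightarrow> bool" where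
  "preorder G r \<longleftrightarrow> right_preorder G r \<and>
     (\<forall>a b. \<forall>t\<in>carrier G. (a, b) \<in> r \<longrightarrow> (t \<otimes>\<^bsub>G\<^esub> a, t \<otimes>\<^bsub>G\<^esub> b) \<in> r)"

definition precone :: "'a ogroup \<Rightarrow> 'a rel \<Rightarrow> 'a set" where
  "precone G r = {a \<in> carrier G. (\<one>\<^bsub>G\<^esub>, a) \<in> r}"

definition precone_rel :: "'a ogroup \<Rightarrow> 'a set \<Rightarrow> 'a rel" where
  "precone_rel G C =
     {(a, b). a \<in> carrier G \<and> b \<in> carrier G \<and> b \<otimes>\<^bsub>G\<^esub> inv\<^bsub>G\<^esub> a \<in> C}"

lemma precone_rel_precone:
  fixes G :: "'a ogroup" (structure)
  assumes "group G" and r: "right_preorder G r"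
  shows "precone_rel G (precone G r) = r"
proof -
  interpret group G by fact
  have right: "(a \<otimes> t, b \<otimes> t) \<in> r" if "(a, b) \<in> r" "t \<in> carrier G" for a b t
    using r that unfolding right_preorder_def by blast
  have sub: "r \<subseteq> carrier G \<times> carrier G"
    using r unfolding right_preorder_def by blast
  have "(\<one>, b \<otimes> inv a) \<in> r \<longleftrightarrow> (a, b) \<in> r" if "a \<in> carrier G" "b \<in> carrier G" for a b
    using right[of \<one> "b \<otimes> inv a" a] right[of a b "inv a"] that by (auto simp: m_assoc)
  with sub show ?thesis
    unfolding precone_rel_def precone_def by auto
qed

lemma precone_iff:
  fixes G :: "'a ogroup" (structure)
  assumes "po_group G"
  shows "(\<exists>r. right_preorder G r \<and> C = precone G r) \<longleftrightarrow>
    C \<subset> carrier G \<and> \<one> \<in> C \<and> (\<forall>a\<in>C. \<forall>b\<in>C. a \<otimes> b \<in> C) \<and>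
    carrier G = C \<union> m_inv G ` C \<and> {a \<in> carrier G. \<one> \<preceq> a} \<subseteq> C"
    (is "?L \<longleftrightarrow> ?R")
proof
  interpret po_group G by fact
  {
    assume ?L
    then obtain r where r: "right_preorder G r" and C: "C = precone G r" by blast
    have right: "(a \<otimes> t, b \<otimes> t) \<in> r" if "(a, b) \<in> r" "t \<in> carrier G" for a b t
      using r that unfolding right_preorder_def by blast
    have rel: "precone_rel G C = r"
      using precone_rel_precone[OF is_group r] C by simp
    have sub: "C \<subseteq> carrier G" unfolding C precone_def by blast
    have "C \<noteq> carrier G"
    proof
      assume "C = carrier G"
      then have "r = carrier G \<times> carrier G"
        unfolding rel[symmetric] precone_rel_def by auto
      with r show False unfolding right_preorder_def by blast
    qed
    moreover have "\<one> \<in> C"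
      using r unfolding C precone_def right_preorder_def refl_on_def by auto
    moreover have "a \<otimes> b \<in> C" if "a \<in> C" "b \<in> C" for a b
    proof -
      have "(b, a \<otimes> b) \<in> r"
        using right[of \<one> a b] that unfolding C precone_def by auto
      with that r show ?thesis
        unfolding C precone_def right_preorder_def by (auto elim: transE)
    qed
    moreover have "a \<in> C \<union> m_inv G ` C" if a: "a \<in> carrier G" for a
    proof (cases "a \<in> C")
      case False
      then have "(a, \<one>) \<in> r"
        using r a unfolding C precone_def right_preorder_def total_on_def refl_on_def
        by (metis (mono_tags, lifting) mem_Collect_eq one_closed)
      then have "inv a \<in> C"
        using right[of a \<one> "inv a"] a unfolding C precone_def by auto
      then show ?thesis using a by (metis UnI2 image_eqI inv_inv)
    qed simp
    moreover have "{a \<in> carrier G. \<one> \<preceq> a} \<subseteq> C"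
      using r unfolding C precone_def right_preorder_def by auto
    ultimately show ?R using sub by auto
  }
  {
    assume R: ?R
    then have sub: "C \<subseteq> carrier G" by blast
    have "right_preorder G (precone_rel G C)"
      unfolding right_preorder_def
    proof (intro conjI ballI allI impI)
      show "precone_rel G C \<subseteq> carrier G \<times> carrier G" unfolding precone_rel_def by auto
      show "refl_on (carrier G) (precone_rel G C)"
        using R unfolding precone_rel_def refl_on_def by simp
      show "trans (precone_rel G C)"
      proof (rule transI)
        fix a b c assume h: "(a, b) \<in> precone_rel G C" "(b, c) \<in> precone_rel G C"
        then have cl: "a \<in> carrier G" "b \<in> carrier G" "c \<in> carrier G"
          unfolding precone_rel_def by auto
        have "(c \<otimes> inv b) \<otimes> (b \<otimes> inv a) \<in> C" using h R unfolding precone_rel_def by blast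
        also have "(c \<otimes> inv b) \<otimes> (b \<otimes> inv a) = c \<otimes> inv a"
          using cl by (metis inv_closed l_inv l_one m_assoc m_closed)
        finally show "(a, c) \<in> precone_rel G C" using cl unfolding precone_rel_def by auto
      qed
      show "total_on (carrier G) (precone_rel G C)"
      proof (rule total_onI)
        fix a b assume cl: "a \<in> carrier G" "b \<in> carrier G"
        then have "b \<otimes> inv a \<in> C \<union> m_inv G ` C" using R by (metis inv_closed m_closed)
        then show "(a, b) \<in> precone_rel G C \<or> (b, a) \<in> precone_rel G C"
        proof
          assume "b \<otimes> inv a \<in> m_inv G ` C"
          then obtain c where c: "c \<in> C" "b \<otimes> inv a = inv c" by blast
          then have "c = a \<otimes> inv b"
            using cl sub by (metis inv_inv inv_mult_group inv_closed subsetD)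
          then show ?thesis using c cl unfolding precone_rel_def by auto
        qed (use cl in \<open>auto simp: precone_rel_def\<close>)
      qed
      show "precone_rel G C \<noteq> carrier G \<times> carrier G"
      proof
        assume eq: "precone_rel G C = carrier G \<times> carrier G"
        have "a \<in> C" if "a \<in> carrier G" for a
        proof -
          have "(\<one>, a) \<in> precone_rel G C" using eq that by auto
          then show ?thesis using that unfolding precone_rel_def by auto
        qed
        with R show False by blast
      qed
    next
      fix a b assume cl: "a \<in> carrier G" "b \<in> carrier G" and "a \<preceq> b"
      then have "\<one> \<otimes> a \<otimes> inv a \<preceq> \<one> \<otimes> b \<otimes> inv a"
        by (intro translation_invariant) auto
      then have "\<one> \<preceq> b \<otimes> inv a" using cl by simp
      moreover have "b \<otimes> inv a \<in> carrier G" using cl by simp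
      ultimately have "b \<otimes> inv a \<in> C" using R by blast
      then show "(a, b) \<in> precone_rel G C"
        using cl unfolding precone_rel_def by simp
    next
      fix a b t assume t: "t \<in> carrier G" and h: "(a, b) \<in> precone_rel G C"
      then have cl: "a \<in> carrier G" "b \<in> carrier G" unfolding precone_rel_def by auto
      have "(b \<otimes> t) \<otimes> inv (a \<otimes> t) = b \<otimes> inv a"
        using cl t by (metis inv_closed inv_mult_group inv_solve_right m_assoc m_closed)
      then show "(a \<otimes> t, b \<otimes> t) \<in> precone_rel G C"
        using h t unfolding precone_rel_def by auto
    qed
    moreover have "C = precone G (precone_rel G C)"
      using sub unfolding precone_def precone_rel_def by auto
    ultimately show ?L by blast
  }
qed

definition equiv_rel :: "'a ogroup \<Rightarrow> 'a set \<Rightarrow> 'a rel" where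
  "equiv_rel G C = precone_rel G C \<inter> (precone_rel G C)\<inverse>"

definition Omega :: "'a ogroup \<Rightarrow> 'a set \<Rightarrow> 'a set gorder" where
  "Omega G C =
     \<lparr>carrier = carrier G // equiv_rel G C,
      eq = (=),
      le = (\<lambda>X Y. \<exists>a\<in>X. \<exists>b\<in>Y. (a, b) \<in> precone_rel G C)\<rparr>"

text \<open>The product of \<open>f\<close> and \<open>g\<close> is ``\<open>g\<close> after \<open>f\<close>''.  The order is pointwise; when \<open>P\<close> is a
  chain, so are the joins and meets that it induces.\<close>

definition Aut :: "'a gorder \<Rightarrow> ('a \<Rightarrow> 'a) ogroup" where
  "Aut P =
     \<lparr>carrier = {f \<in> Bij (carrier P).
        \<forall>x\<in>carrier P. \<forall>y\<in>carrier P. x \<sqsubseteq>\<^bsub>P\<^esub> y \<longrightarrow> f x \<sqsubseteq>\<^bsub>P\<^esub> f y},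
      mult = (\<lambda>f g. compose (carrier P) g f),
      one = (\<lambda>x\<in>carrier P. x),
      leq = (\<lambda>f g. \<forall>x\<in>carrier P. f x \<sqsubseteq>\<^bsub>P\<^esub> g x)\<rparr>"

text \<open>The map sending the class of \<open>b\<close> to the class of \<open>b a\<close>; the union is over
  representatives, whose images all lie in the same class.\<close>

definition R_map :: "'a ogroup \<Rightarrow> 'a set \<Rightarrow> 'a \<Rightarrow> 'a set \<Rightarrow> 'a set" where
  "R_map G C a = (\<lambda>X\<in>carrier (Omega G C). \<Union>b\<in>X. equiv_rel G C `` {b \<otimes>\<^bsub>G\<^esub> a})"

definition H_lgroup :: "'a ogroup \<Rightarrow> 'a set \<Rightarrow> ('a set \<Rightarrow> 'a set) ogroup" where
  "H_lgroup G C = (Aut (Omega G C))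
     \<lparr>carrier := lsubgroup_generated (Aut (Omega G C)) (R_map G C ` carrier G)\<rparr>"

definition PV :: "(lterm \<times> lterm) set \<Rightarrow> 'a ogroup \<Rightarrow> 'a set set" where
  "PV V G = {C. (\<exists>r. right_preorder G r \<and> C = precone G r) \<and> in_variety (H_lgroup G C) V}"

definition BV :: "(lterm \<times> lterm) set \<Rightarrow> 'a ogroup \<Rightarrow> 'a set set" where
  "BV V G = {C \<in> PV V G. \<exists>r. preorder G r \<and> C = precone G r}"

definition PV_topology :: "(lterm \<times> lterm) set \<Rightarrow> 'a ogroup \<Rightarrow> 'a set topology" where
  "PV_topology V G = topology_generated_by
     (insert (PV V G) {{C \<in> PV V G. a \<in> C \<and> inv\<^bsub>G\<^esub> a \<notin> C} | a. a \<in> carrier G})"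

definition BV_topology :: "(lterm \<times> lterm) set \<Rightarrow> 'a ogroup \<Rightarrow> 'a set topology" where
  "BV_topology V G = subtopology (PV_topology V G) (BV V G)"

definition beta :: "'a ogroup \<Rightarrow> 'a set \<Rightarrow> 'a set" where
  "beta G C = (\<Inter>t\<in>carrier G. (inv\<^bsub>G\<^esub> t <#\<^bsub>G\<^esub> C) #>\<^bsub>G\<^esub> t)"

definition irreducible_closedin :: "'a topology \<Rightarrow> 'a set \<Rightarrow> bool" where
  "irreducible_closedin X S \<longleftrightarrow> closedin X S \<and> S \<noteq> {} \<and>
     (\<forall>A B. closedin X A \<and> closedin X B \<and> S = A \<union> B \<longrightarrow> S = A \<or> S = B)"

definition sober_space :: "'a topology \<Rightarrow> bool" where
  "sober_space X \<longleftrightarrow>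
     (\<forall>S. irreducible_closedin X S \<longrightarrow> (\<exists>!x. x \<in> topspace X \<and> S = X closure_of {x}))"

definition compact_opens :: "'a topology \<Rightarrow> 'a set set" where
  "compact_opens X = {U. openin X U \<and> compactin X U}"

definition generalised_spectral_space :: "'a topology \<Rightarrow> bool" where
  "generalised_spectral_space X \<longleftrightarrow> sober_space X \<and>
     (\<forall>U. openin X U \<longrightarrow> (\<exists>\<U>\<subseteq>compact_opens X. U = \<Union>\<U>)) \<and>
     (\<forall>\<F>. finite \<F> \<and> \<F> \<noteq> {} \<and> \<F> \<subseteq> compact_opens X \<longrightarrow> \<Inter>\<F> \<in> compact_opens X)"

definition interior_operator_on :: "'a::order set \<Rightarrow> ('a \<Rightarrow> 'a) \<Rightarrow> bool" where
  "interior_operator_on S \<iota> \<longleftrightarrow> \<iota> \<in> S \<rightarrow> S \<and> (\<forall>x\<in>S. \<iota> x \<le> x) \<and> mono_on S \<iota> \<and>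
     (\<forall>x\<in>S. \<iota> (\<iota> x) = \<iota> x)"

definition open_elements :: "'a set \<Rightarrow> ('a \<Rightarrow> 'a) \<Rightarrow> 'a set" where
  "open_elements S \<iota> = {x \<in> S. \<iota> x = x}"

end

theory Submission
  imports Defs "HOL-Library.Countable_Set" "HOL-Analysis.Function_Topology"
begin

text \<open>Representability of the members of \<open>V\<close> amounts to the inequality
  \<open>e \<le> x \<or> y\<inverse> x\<inverse> y\<close>, and in \<open>H\<^sub>C\<close> this inequality forces the intersection \<open>\<beta>(C)\<close> of the
  conjugates of \<open>C\<close> to be total.  Then \<open>R\<^sub>C[G]\<close> is totally ordered, so it is all of \<open>H\<^sub>C\<close>, and
  \<open>H\<^sub>C \<in> V\<close> becomes a condition on the normal submonoid \<open>\<beta>(C)\<close> alone, namely that the equations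
  of \<open>V\<close> hold in \<open>G\<close> modulo \<open>\<beta>(C)\<close>.  This gives the statements about \<open>\<beta>\<close>.  As a violation of that
  condition involves only finitely many elements of \<open>G\<close>, the pre-orders avoiding a given nonempty
  finite set correspond to a closed subset of the Cantor cube \<open>{0,1}\<^sup>G\<close>, hence form a compact open
  set; and an irreducible closed set \<open>S\<close> has the generic point \<open>\<Inter>S\<close>.\<close>

text \<open>The assumption on \<open>V\<close> speaks of lattice-groups on \<open>nat\<close>, while
  H_C consists of maps between sets of elements of G. The inequality crosses this gap because it has
  two variables, and the l-subgroup generated by two elements is countable, hence has a copy on
  \<open>nat\<close>.

  Conjugates enter because R_C(a) and R_C(b) are compared at every class [x], and the comparison at
  [x] concerns x b a^-1 x^-1.

  The obstacle to compactness is properness: a limit of proper cones in the Cantor cube may be all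
  of G, so the pre-orders alone need not form a closed set. The conditions are therefore split.
  \<open>normal_cone\<close> admits the whole group, and each instance of its clauses concerns
  finitely many memberships; properness is enforced by avoiding a nonempty finite set. This is why
  the space is only generalised spectral. The same finite character makes \<Inter>S a normal cone,
  as irreducibility lets it agree on each finite set with some member of S.\<close>

lemma ord_of_simps [simp]:
  "carrier (ord_of L) = carrier L" "eq (ord_of L) = (=)" "le (ord_of L) = leq L"
  by (simp_all add: ord_of_def)

lemma po_groupI:
  fixes G (structure)
  assumes "group G"
    and "\<And>x. x \<in> carrier G \<Longrightarrow> x \<preceq> x"
    and "\<And>x y. \<lbrakk>x \<in> carrier G; y \<in> carrier G; x \<preceq> y; y \<preceq> x\<rbrakk> \<Longrightarrow> x = y"
    and "\<And>x y z. \<lbrakk>x \<in> carrier G; y \<in> carrier G; z \<in> carrier G; x \<preceq> y; y \<preceq> z\<rbrakk> \<Longrightarrow> x \<preceq> z"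
    and "\<And>a b s t. \<lbrakk>a \<in> carrier G; b \<in> carrier G; s \<in> carrier G; t \<in> carrier G; a \<preceq> b\<rbrakk>
      \<Longrightarrow> s \<otimes> a \<otimes> t \<preceq> s \<otimes> b \<otimes> t"
  shows "po_group G"
proof -
  have "partial_order (ord_of G)"
    by (unfold_locales; simp; metis assms(2-4))
  then show ?thesis
    using assms(1,5) by (intro po_group.intro po_group_axioms.intro)
qed

lemma (in po_group) leq_refl: "x \<in> carrier G \<Longrightarrow> x \<preceq> x"
  using le_refl[of x] by simp

lemma (in po_group) leq_trans:
  "\<lbrakk>x \<preceq> y; y \<preceq> z; x \<in> carrier G; y \<in> carrier G; z \<in> carrier G\<rbrakk> \<Longrightarrow> x \<preceq> z"
  using le_trans[of x y z] by simp

lemma (in po_group) leq_antisym: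
  "\<lbrakk>x \<preceq> y; y \<preceq> x; x \<in> carrier G; y \<in> carrier G\<rbrakk> \<Longrightarrow> x = y"
  using le_antisym[of x y] by simp

text \<open>\<open>ljoin\<close> is a choice among least upper bounds. The relational form can be
  verified for a candidate first and identified with the chosen value afterwards.\<close>

definition is_ljoin :: "('a, 'b) ogroup_scheme \<Rightarrow> 'a \<Rightarrow> 'a \<Rightarrow> 'a \<Rightarrow> bool" where
  "is_ljoin L x y z \<longleftrightarrow> z \<in> carrier L \<and> x \<preceq>\<^bsub>L\<^esub> z \<and> y \<preceq>\<^bsub>L\<^esub> z \<and>
     (\<forall>w\<in>carrier L. x \<preceq>\<^bsub>L\<^esub> w \<longrightarrow> y \<preceq>\<^bsub>L\<^esub> w \<longrightarrow> z \<preceq>\<^bsub>L\<^esub> w)"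

definition is_lmeet :: "('a, 'b) ogroup_scheme \<Rightarrow> 'a \<Rightarrow> 'a \<Rightarrow> 'a \<Rightarrow> bool" where
  "is_lmeet L x y z \<longleftrightarrow> z \<in> carrier L \<and> z \<preceq>\<^bsub>L\<^esub> x \<and> z \<preceq>\<^bsub>L\<^esub> y \<and>
     (\<forall>w\<in>carrier L. w \<preceq>\<^bsub>L\<^esub> x \<longrightarrow> w \<preceq>\<^bsub>L\<^esub> y \<longrightarrow> w \<preceq>\<^bsub>L\<^esub> z)"

lemma least_Upper_iff:
  assumes "x \<in> carrier L" "y \<in> carrier L"
  shows "least (ord_of L) z (Upper (ord_of L) {x, y}) \<longleftrightarrow> is_ljoin L x y z"
  using assms unfolding least_def Upper_def is_ljoin_def by auto

lemma greatest_Lower_iff: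
  assumes "x \<in> carrier L" "y \<in> carrier L"
  shows "greatest (ord_of L) z (Lower (ord_of L) {x, y}) \<longleftrightarrow> is_lmeet L x y z"
  using assms unfolding greatest_def Lower_def is_lmeet_def by auto

lemma lgroupI:
  assumes "po_group L"
    and "\<And>x y. \<lbrakk>x \<in> carrier L; y \<in> carrier L\<rbrakk> \<Longrightarrow> \<exists>z. is_ljoin L x y z"
    and "\<And>x y. \<lbrakk>x \<in> carrier L; y \<in> carrier L\<rbrakk> \<Longrightarrow> \<exists>z. is_lmeet L x y z"
  shows "lgroup L"
proof -
  interpret po_group L by fact
  have "lattice (ord_of L)"
    by unfold_locales (use assms in \<open>auto simp: least_Upper_iff greatest_Lower_iff\<close>)
  then show ?thesis using assms by (intro lgroup.intro)
qed

lemma (in lgroup) is_ljoin_ljoin: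
  assumes "x \<in> carrier G" "y \<in> carrier G"
  shows "is_ljoin G x y (ljoin G x y)"
proof -
  have "\<exists>z. least (ord_of G) z (Upper (ord_of G) {x, y})"
    using sup_of_two_exists assms by simp
  then have "least (ord_of G) (ljoin G x y) (Upper (ord_of G) {x, y})"
    unfolding ljoin_def join_def Lattice.sup_def by (rule someI_ex)
  then show ?thesis using assms by (simp add: least_Upper_iff)
qed

lemma (in lgroup) is_lmeet_lmeet:
  assumes "x \<in> carrier G" "y \<in> carrier G"
  shows "is_lmeet G x y (lmeet G x y)"
proof -
  have "\<exists>z. greatest (ord_of G) z (Lower (ord_of G) {x, y})"
    using inf_of_two_exists assms by simp
  then have "greatest (ord_of G) (lmeet G x y) (Lower (ord_of G) {x, y})"
    unfolding lmeet_def meet_def Lattice.inf_def by (rule someI_ex)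
  then show ?thesis using assms by (simp add: greatest_Lower_iff)
qed

text \<open>Antisymmetry makes the least upper bound unique, whatever the choice operator picks.
  Stated for a bare structure, the lemma applies directly to \<open>product_ogroup\<close>.\<close>

lemma ljoin_eqI:
  assumes anti: "\<And>u v. \<lbrakk>u \<in> carrier L; v \<in> carrier L; u \<preceq>\<^bsub>L\<^esub> v; v \<preceq>\<^bsub>L\<^esub> u\<rbrakk> \<Longrightarrow> u = v"
    and xy: "x \<in> carrier L" "y \<in> carrier L" and z: "is_ljoin L x y z"
  shows "ljoin L x y = z"
proof -
  have "is_ljoin L x y (ljoin L x y)"
    unfolding ljoin_def join_def Lattice.sup_def
    using someI[of "\<lambda>z. least (ord_of L) z (Upper (ord_of L) {x, y})" z] z xy
    by (simp add: least_Upper_iff)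
  then show ?thesis using z anti unfolding is_ljoin_def by blast
qed

lemma lmeet_eqI:
  assumes anti: "\<And>u v. \<lbrakk>u \<in> carrier L; v \<in> carrier L; u \<preceq>\<^bsub>L\<^esub> v; v \<preceq>\<^bsub>L\<^esub> u\<rbrakk> \<Longrightarrow> u = v"
    and xy: "x \<in> carrier L" "y \<in> carrier L" and z: "is_lmeet L x y z"
  shows "lmeet L x y = z"
proof -
  have "is_lmeet L x y (lmeet L x y)"
    unfolding lmeet_def meet_def Lattice.inf_def
    using someI[of "\<lambda>z. greatest (ord_of L) z (Lower (ord_of L) {x, y})" z] z xy
    by (simp add: greatest_Lower_iff)
  then show ?thesis using z anti unfolding is_lmeet_def by blast
qed

lemma (in po_group) ljoin_eq: "\<lbrakk>x \<in> carrier G; y \<in> carrier G; is_ljoin G x y z\<rbrakk> \<Longrightarrow> ljoin G x y = z"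
  by (rule ljoin_eqI[OF leq_antisym])

lemma (in po_group) lmeet_eq: "\<lbrakk>x \<in> carrier G; y \<in> carrier G; is_lmeet G x y z\<rbrakk> \<Longrightarrow> lmeet G x y = z"
  by (rule lmeet_eqI[OF leq_antisym])

lemma (in lgroup) lterm_val_closed:
  "range \<rho> \<subseteq> carrier G \<Longrightarrow> lterm_val G \<rho> s \<in> carrier G"
  using is_ljoin_ljoin is_lmeet_lmeet
  by (induction s) (auto simp: is_ljoin_def is_lmeet_def)

text \<open>\<open>K\<close> is a bare structure at the outset; its group laws, order laws, joins
  and meets are all pulled back from the l-subgroup that is its image. There are two uses: a
  countable l-subgroup copied to \<open>nat\<close>, and H_C inside the automorphisms of
  Omega_C.\<close>

locale lgroup_embedding =
  L: lgroup L for K :: "('a, 'c) ogroup_scheme" and L :: "('b, 'd) ogroup_scheme" and h +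
  assumes image: "lsubgroup (h ` carrier K) L"
    and inj: "inj_on h (carrier K)"
    and mult_closed: "\<lbrakk>x \<in> carrier K; y \<in> carrier K\<rbrakk> \<Longrightarrow> x \<otimes>\<^bsub>K\<^esub> y \<in> carrier K"
    and one_closed: "\<one>\<^bsub>K\<^esub> \<in> carrier K"
    and h_mult: "\<lbrakk>x \<in> carrier K; y \<in> carrier K\<rbrakk> \<Longrightarrow> h (x \<otimes>\<^bsub>K\<^esub> y) = h x \<otimes>\<^bsub>L\<^esub> h y"
    and h_one: "h \<one>\<^bsub>K\<^esub> = \<one>\<^bsub>L\<^esub>"
    and h_leq: "\<lbrakk>x \<in> carrier K; y \<in> carrier K\<rbrakk> \<Longrightarrow> x \<preceq>\<^bsub>K\<^esub> y \<longleftrightarrow> h x \<preceq>\<^bsub>L\<^esub> h y"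
begin

lemma h_closed: "x \<in> carrier K \<Longrightarrow> h x \<in> carrier L"
  using image subgroup.subset unfolding lsubgroup_def by blast

lemma h_eqD: "\<lbrakk>h x = h y; x \<in> carrier K; y \<in> carrier K\<rbrakk> \<Longrightarrow> x = y"
  using inj by (meson inj_onD)

lemma po_group_K: "po_group K"
proof (rule po_groupI)
  show "group K"
  proof (rule groupI)
    fix x assume x: "x \<in> carrier K"
    then have "inv\<^bsub>L\<^esub> h x \<in> h ` carrier K"
      using image unfolding lsubgroup_def by (simp add: subgroup.m_inv_closed)
    then obtain y where y: "y \<in> carrier K" "h y = inv\<^bsub>L\<^esub> h x" by auto
    then have "h (y \<otimes>\<^bsub>K\<^esub> x) = h \<one>\<^bsub>K\<^esub>"
      using x h_mult h_one h_closed L.l_inv by simp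
    then have "y \<otimes>\<^bsub>K\<^esub> x = \<one>\<^bsub>K\<^esub>" using h_eqD x y one_closed mult_closed by blast
    then show "\<exists>y\<in>carrier K. y \<otimes>\<^bsub>K\<^esub> x = \<one>\<^bsub>K\<^esub>" using y by blast
  next
    fix x y z assume xyz: "x \<in> carrier K" "y \<in> carrier K" "z \<in> carrier K"
    show "x \<otimes>\<^bsub>K\<^esub> y \<otimes>\<^bsub>K\<^esub> z = x \<otimes>\<^bsub>K\<^esub> (y \<otimes>\<^bsub>K\<^esub> z)"
      by (rule h_eqD) (use xyz in \<open>simp_all add: mult_closed h_mult h_closed L.m_assoc\<close>)
  next
    fix x assume x: "x \<in> carrier K"
    show "\<one>\<^bsub>K\<^esub> \<otimes>\<^bsub>K\<^esub> x = x"
      by (rule h_eqD) (use x in \<open>simp_all add: mult_closed one_closed h_one h_mult h_closed\<close>)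
  qed (simp_all add: mult_closed one_closed)
next
  fix x y assume "x \<in> carrier K" "y \<in> carrier K" "x \<preceq>\<^bsub>K\<^esub> y" "y \<preceq>\<^bsub>K\<^esub> x"
  then show "x = y"
    using L.leq_antisym[of "h x" "h y"] by (simp add: h_leq h_closed h_eqD)
next
  fix x y z assume "x \<in> carrier K" "y \<in> carrier K" "z \<in> carrier K" "x \<preceq>\<^bsub>K\<^esub> y" "y \<preceq>\<^bsub>K\<^esub> z"
  then show "x \<preceq>\<^bsub>K\<^esub> z"
    using L.leq_trans[of "h x" "h y" "h z"] by (simp add: h_leq h_closed)
next
  fix a b s t assume *: "a \<in> carrier K" "b \<in> carrier K" "s \<in> carrier K" "t \<in> carrier K" "a \<preceq>\<^bsub>K\<^esub> b"
  then show "s \<otimes>\<^bsub>K\<^esub> a \<otimes>\<^bsub>K\<^esub> t \<preceq>\<^bsub>K\<^esub> s \<otimes>\<^bsub>K\<^esub> b \<otimes>\<^bsub>K\<^esub> t"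
    using L.translation_invariant by (simp add: mult_closed h_mult h_closed h_leq)
qed (simp add: h_leq h_closed L.leq_refl)

lemma is_ljoin_K:
  assumes "x \<in> carrier K" "y \<in> carrier K"
  shows "\<exists>z. is_ljoin K x y z \<and> h z = ljoin L (h x) (h y)"
proof -
  obtain z where z: "z \<in> carrier K" "h z = ljoin L (h x) (h y)"
    using image assms unfolding lsubgroup_def by (metis image_iff imageI)
  moreover have "is_ljoin K x y z"
    using L.is_ljoin_ljoin[OF h_closed h_closed, of x y] z assms
    unfolding is_ljoin_def by (auto simp: h_leq h_closed)
  ultimately show ?thesis by blast
qed

lemma is_lmeet_K:
  assumes "x \<in> carrier K" "y \<in> carrier K"
  shows "\<exists>z. is_lmeet K x y z \<and> h z = lmeet L (h x) (h y)"
proof -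
  obtain z where z: "z \<in> carrier K" "h z = lmeet L (h x) (h y)"
    using image assms unfolding lsubgroup_def by (metis image_iff imageI)
  moreover have "is_lmeet K x y z"
    using L.is_lmeet_lmeet[OF h_closed h_closed, of x y] z assms
    unfolding is_lmeet_def by (auto simp: h_leq h_closed)
  ultimately show ?thesis by blast
qed

lemma lgroup_K: "lgroup K"
  by (rule lgroupI[OF po_group_K]) (use is_ljoin_K is_lmeet_K in blast)+

sublocale K: lgroup K by (rule lgroup_K)

lemma h_ljoin: "\<lbrakk>x \<in> carrier K; y \<in> carrier K\<rbrakk> \<Longrightarrow> h (ljoin K x y) = ljoin L (h x) (h y)"
  using is_ljoin_K K.ljoin_eq by metis

lemma h_lmeet: "\<lbrakk>x \<in> carrier K; y \<in> carrier K\<rbrakk> \<Longrightarrow> h (lmeet K x y) = lmeet L (h x) (h y)"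
  using is_lmeet_K K.lmeet_eq by metis

lemma h_inv: "x \<in> carrier K \<Longrightarrow> h (inv\<^bsub>K\<^esub> x) = inv\<^bsub>L\<^esub> h x"
  by (metis K.inv_closed K.l_inv L.inv_equality h_closed h_mult h_one)

lemma h_lterm_val:
  "range \<rho> \<subseteq> carrier K \<Longrightarrow> h (lterm_val K \<rho> s) = lterm_val L (h \<circ> \<rho>) s"
  by (induction s)
    (simp_all add: h_one h_inv h_mult h_ljoin h_lmeet K.lterm_val_closed)

lemma in_variety_K:
  assumes "in_variety L V"
  shows "in_variety K V"
  unfolding in_variety_def
proof (intro conjI ballI allI impI, clarify?)
  show "lgroup K" by (rule lgroup_K)
next
  fix st assume st: "st \<in> V"
  obtain s t where [simp]: "st = (s, t)" by fastforce
  have "lterm_val K \<rho> s = lterm_val K \<rho> t" if r: "range \<rho> \<subseteq> carrier K" for \<rho>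
  proof (rule h_eqD)
    have "range (h \<circ> \<rho>) \<subseteq> carrier L" using r h_closed by auto
    then show "h (lterm_val K \<rho> s) = h (lterm_val K \<rho> t)"
      using assms st r unfolding in_variety_def by (auto simp: h_lterm_val)
  qed (use r K.lterm_val_closed in auto)
  then show "case st of (s, t) \<Rightarrow> \<forall>\<rho>. range \<rho> \<subseteq> carrier K \<longrightarrow> lterm_val K \<rho> s = lterm_val K \<rho> t"
    by simp
qed

end

subsection \<open>The inequality of representable lattice-ordered groups\<close>

lemma product_ogroup_simps [simp]:
  "carrier (product_ogroup I T) = (\<Pi>\<^sub>E i\<in>I. carrier (T i))"
  "mult (product_ogroup I T) = (\<lambda>x y. \<lambda>i\<in>I. x i \<otimes>\<^bsub>T i\<^esub> y i)"
  "x \<preceq>\<^bsub>product_ogroup I T\<^esub> y \<longleftrightarrow> (\<forall>i\<in>I. x i \<preceq>\<^bsub>T i\<^esub> y i)"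
  by (simp_all add: product_ogroup_def product_group_def)

lemma product_ogroup_antisym:
  assumes "\<And>i. i \<in> I \<Longrightarrow> po_group (T i)"
    and "x \<in> carrier (product_ogroup I T)" "y \<in> carrier (product_ogroup I T)"
    and "x \<preceq>\<^bsub>product_ogroup I T\<^esub> y" "y \<preceq>\<^bsub>product_ogroup I T\<^esub> x"
  shows "x = y"
proof (rule PiE_ext)
  show "x i = y i" if "i \<in> I" for i
    using assms that by (intro po_group.leq_antisym[of "T i"]) (auto simp: PiE_iff)
qed (use assms in simp_all)

text \<open>In a product of chains the coordinatewise maximum \<open>?m\<close> is a join, and
  antisymmetry identifies \<open>ljoin\<close> with it. The join is thus an upper bound in every
  coordinate.\<close>

lemma ljoin_product_ogroup_upper:
  assumes T: "\<And>i. i \<in> I \<Longrightarrow> totally_ordered_group (T i)"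
    and x: "x \<in> carrier (product_ogroup I T)" and y: "y \<in> carrier (product_ogroup I T)"
    and i: "i \<in> I"
  shows "x i \<preceq>\<^bsub>T i\<^esub> ljoin (product_ogroup I T) x y i \<and> y i \<preceq>\<^bsub>T i\<^esub> ljoin (product_ogroup I T) x y i"
proof -
  let ?m = "\<lambda>i\<in>I. if x i \<preceq>\<^bsub>T i\<^esub> y i then y i else x i"
  have po: "po_group (T i)" if "i \<in> I" for i
    using T[OF that] by (simp add: totally_ordered_group_def)
  have total: "a \<preceq>\<^bsub>T i\<^esub> b \<or> b \<preceq>\<^bsub>T i\<^esub> a" if "i \<in> I" "a \<in> carrier (T i)" "b \<in> carrier (T i)" for i a b
    using total_order.total_order_total[of "ord_of (T i)" a b] T[OF that(1)] that
    by (simp add: totally_ordered_group_def)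
  have cl: "x i \<in> carrier (T i)" "y i \<in> carrier (T i)" if "i \<in> I" for i
    using x y that by auto
  have nle: "y i \<preceq>\<^bsub>T i\<^esub> x i" if "i \<in> I" "\<not> x i \<preceq>\<^bsub>T i\<^esub> y i" for i
    using total[of i "x i" "y i"] cl that by blast
  have "is_ljoin (product_ogroup I T) x y ?m"
    unfolding is_ljoin_def using cl po_group.leq_refl[OF po] nle by (auto simp: PiE_iff)
  moreover from this have "ljoin (product_ogroup I T) x y = ?m"
    using product_ogroup_antisym[of I T] po x y by (intro ljoin_eqI) blast+
  ultimately show ?thesis using i unfolding is_ljoin_def by simp
qed

text \<open>If x is not above the identity, then it lies below it. Multiplying that inequality by
  y^-1 x^-1 on the left and by y on the right makes the conjugate of x^-1 positive.\<close>

lemma (in totally_ordered_group) one_le_or_one_le_conj_inv: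
  assumes x: "x \<in> carrier G" and y: "y \<in> carrier G"
  shows "\<one> \<preceq> x \<or> \<one> \<preceq> inv y \<otimes> inv x \<otimes> y"
proof (cases "\<one> \<preceq> x")
  case False
  then have "x \<preceq> \<one>" using total_order_total[of x \<one>] x by simp
  then have "(inv y \<otimes> inv x) \<otimes> x \<otimes> y \<preceq> (inv y \<otimes> inv x) \<otimes> \<one> \<otimes> y"
    using x y by (intro translation_invariant) auto
  moreover have "(inv y \<otimes> inv x) \<otimes> x \<otimes> y = \<one>" using x y by (simp add: m_assoc)
  ultimately show ?thesis using x y by simp
qed simp

text \<open>The inequality between the identity and \<open>?j\<close> holds in every coordinate,
  since the coordinates are chains. It is phrased as an equation between joins because
  \<open>h\<close> is injective and preserves operations, so that an equation can be pulled back
  along it.\<close>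

lemma representable_identity:
  fixes L :: "'a ogroup" (structure)
  assumes "representable L" and x: "x \<in> carrier L" and y: "y \<in> carrier L"
  shows "ljoin L \<one> (ljoin L x (inv y \<otimes> inv x \<otimes> y)) = ljoin L x (inv y \<otimes> inv x \<otimes> y)"
proof -
  interpret lgroup L using assms by (simp add: representable_def)
  from assms(1) obtain I :: "'a set set" and T :: "'a set \<Rightarrow> 'a set ogroup" and h
    where "\<forall>i\<in>I. totally_ordered_group (T i)"
    and h: "h \<in> lhom L (product_ogroup I T)" and inj: "inj_on h (carrier L)"
    unfolding representable_def by (elim conjE exE)
  then have T: "totally_ordered_group (T i)" if "i \<in> I" for i
    using that by simp
  let ?P = "product_ogroup I T"
  let ?w = "inv y \<otimes> inv x \<otimes> y"
  let ?j = "ljoin L x ?w"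
  have po: "po_group (T i)" if "i \<in> I" for i
    using T[OF that] by (simp add: totally_ordered_group_def)
  have hcl: "h a \<in> carrier ?P" if "a \<in> carrier L" for a
    using h that unfolding lhom_def hom_def by blast
  have hj: "h (ljoin L a b) = ljoin ?P (h a) (h b)" if "a \<in> carrier L" "b \<in> carrier L" for a b
    using h that unfolding lhom_def by blast
  have cl: "?w \<in> carrier L" using x y by simp
  have jcl: "?j \<in> carrier L" using is_ljoin_ljoin[OF x cl] by (simp add: is_ljoin_def)
  have "h \<one> i \<preceq>\<^bsub>T i\<^esub> h ?j i" if i: "i \<in> I" for i
  proof -
    interpret T: totally_ordered_group "T i" using T[OF i] .
    interpret hi: group_hom L "T i" "\<lambda>a. h a i"
    proof unfold_locales
      show "(\<lambda>a. h a i) \<in> hom L (T i)"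
        using h i hcl unfolding lhom_def hom_def by (auto simp: Pi_iff)
    qed
    have w: "h ?w i = inv\<^bsub>T i\<^esub> h y i \<otimes>\<^bsub>T i\<^esub> inv\<^bsub>T i\<^esub> h x i \<otimes>\<^bsub>T i\<^esub> h y i"
      using x y by simp
    have le: "h x i \<preceq>\<^bsub>T i\<^esub> h ?j i" "h ?w i \<preceq>\<^bsub>T i\<^esub> h ?j i"
      using ljoin_product_ogroup_upper[OF T hcl hcl i, of x ?w] x cl hj[OF x cl] by simp_all
    have "\<one>\<^bsub>T i\<^esub> \<preceq>\<^bsub>T i\<^esub> h x i \<or> \<one>\<^bsub>T i\<^esub> \<preceq>\<^bsub>T i\<^esub> h ?w i"
      unfolding w using T.one_le_or_one_le_conj_inv x y by simp
    then have "\<one>\<^bsub>T i\<^esub> \<preceq>\<^bsub>T i\<^esub> h ?j i"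
      using T.leq_trans[OF _ le(1)] T.leq_trans[OF _ le(2)]
        hi.hom_closed[OF x] hi.hom_closed[OF cl] hi.hom_closed[OF jcl] by blast
    then show ?thesis by (simp only: hi.hom_one)
  qed
  then have "is_ljoin ?P (h \<one>) (h ?j) (h ?j)"
    unfolding is_ljoin_def using hcl[OF jcl] po_group.leq_refl[OF po] by (auto simp: PiE_iff)
  then have "ljoin ?P (h \<one>) (h ?j) = h ?j"
    using product_ogroup_antisym[of I T] po hcl[OF jcl] hcl[OF one_closed] by (intro ljoin_eqI) blast+
  then have "h (ljoin L \<one> ?j) = h ?j" using hj jcl by simp
  moreover have "ljoin L \<one> ?j \<in> carrier L"
    using is_ljoin_ljoin[OF one_closed jcl] by (simp add: is_ljoin_def)
  ultimately show ?thesis using inj jcl by (auto dest: inj_onD)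
qed

text \<open>Countably many terms have countably many values, so the l-subgroup generated by two
  elements is countable.\<close>

instance lterm :: countable by countable_datatype

text \<open>The values of all terms at x and y form a countable l-subgroup \<open>S\<close>. Its
  copy on \<open>nat\<close> satisfies the equations of \<open>V\<close>, so it is representable by
  assumption, and the identity found there is carried back along the embedding.\<close>

lemma representable_variety_identity:
  fixes L (structure)
  assumes V: "representable_variety V" "in_variety L V" and x: "x \<in> carrier L" and y: "y \<in> carrier L"
  shows "ljoin L \<one> (ljoin L x (inv y \<otimes> inv x \<otimes> y)) = ljoin L x (inv y \<otimes> inv x \<otimes> y)"
proof -
  interpret lgroup L using V by (simp add: in_variety_def)
  define \<rho> where "\<rho> n = (if n = 0 then x else y)" for n :: nat
  define S where "S = range (lterm_val L \<rho>)"
  have rho: "range \<rho> \<subseteq> carrier L" using x y by (auto simp: \<rho>_def)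
  have "countable S" unfolding S_def by simp
  define h where "h = from_nat_into S"
  define g where "g = to_nat_on S"
  have hg [simp]: "h (g a) = a" if "a \<in> S" for a
    using from_nat_into_to_nat_on[OF \<open>countable S\<close>] that by (simp add: h_def g_def)
  have S_one: "\<one> \<in> S"
    using rangeI[of "lterm_val L \<rho>" One] by (simp add: S_def)
  have S_inv: "inv a \<in> S" if "a \<in> S" for a
  proof -
    obtain s where "a = lterm_val L \<rho> s" using \<open>a \<in> S\<close> by (auto simp: S_def)
    then show ?thesis using rangeI[of "lterm_val L \<rho>" "Inv s"] by (simp add: S_def)
  qed
  have S_ops: "a \<otimes> b \<in> S" "ljoin L a b \<in> S" "lmeet L a b \<in> S" if ab: "a \<in> S" "b \<in> S" for a b
  proof -
    obtain s t where "a = lterm_val L \<rho> s" "b = lterm_val L \<rho> t"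
      using ab unfolding S_def by blast
    then show "a \<otimes> b \<in> S" "ljoin L a b \<in> S" "lmeet L a b \<in> S"
      using rangeI[of "lterm_val L \<rho>" "Mult s t"] rangeI[of "lterm_val L \<rho>" "Join s t"]
        rangeI[of "lterm_val L \<rho>" "Meet s t"] by (simp_all add: S_def)
  qed
  have S_sub: "S \<subseteq> carrier L" unfolding S_def using lterm_val_closed[OF rho] by blast
  have xyS: "x \<in> S" "y \<in> S"
    unfolding S_def using rangeI[of "lterm_val L \<rho>" "Var 0"] rangeI[of "lterm_val L \<rho>" "Var 1"]
    by (simp_all add: \<rho>_def)
  \<comment> \<open>The structure of \<open>S\<close> is transported along the enumeration
    \<open>g\<close> with left inverse \<open>h\<close>. The carrier is the image of
    \<open>S\<close> and not all of \<open>nat\<close>, because \<open>S\<close> may be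
    trivial.\<close>
  define K :: "nat ogroup" where "K = \<lparr>carrier = g ` S, mult = (\<lambda>m n. g (h m \<otimes> h n)),
    one = g \<one>, leq = (\<lambda>m n. h m \<preceq> h n)\<rparr>"
  have hK: "h ` carrier K = S" by (simp add: K_def image_image)
  have hS: "h m \<in> S" if "m \<in> carrier K" for m using that hK by blast
  interpret lgroup_embedding K L h
  proof unfold_locales
    show "lsubgroup (h ` carrier K) L"
      unfolding hK lsubgroup_def using S_one S_inv S_ops S_sub by (auto intro!: subgroup.intro)
    show "inj_on h (carrier K)" by (auto simp: K_def inj_on_def)
  qed (use S_one S_ops hS in \<open>auto simp: K_def\<close>)
  have K: "representable K" using V in_variety_K by (simp add: representable_variety_def)
  obtain a b where ab: "a \<in> carrier K" "b \<in> carrier K" "h a = x" "h b = y"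
    using xyS hK by blast
  let ?w = "inv\<^bsub>K\<^esub> b \<otimes>\<^bsub>K\<^esub> inv\<^bsub>K\<^esub> a \<otimes>\<^bsub>K\<^esub> b"
  have cl: "?w \<in> carrier K" "ljoin K a ?w \<in> carrier K"
    using ab K.is_ljoin_ljoin[of a ?w] by (simp_all add: is_ljoin_def)
  have "h (ljoin K \<one>\<^bsub>K\<^esub> (ljoin K a ?w)) = h (ljoin K a ?w)"
    using representable_identity[OF K ab(1,2)] by simp
  then show ?thesis using ab cl by (simp add: h_ljoin h_one h_mult h_inv)
qed

subsection \<open>Automorphisms of a chain\<close>

lemma Aut_simps [simp]:
  "mult (Aut P) = (\<lambda>f g. compose (carrier P) g f)"
  "one (Aut P) = (\<lambda>x\<in>carrier P. x)"
  "f \<preceq>\<^bsub>Aut P\<^esub> g \<longleftrightarrow> (\<forall>x\<in>carrier P. f x \<sqsubseteq>\<^bsub>P\<^esub> g x)"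
  by (simp_all add: Aut_def)

lemma carrier_Aut: "f \<in> carrier (Aut P) \<longleftrightarrow> f \<in> Bij (carrier P) \<and>
    (\<forall>x\<in>carrier P. \<forall>y\<in>carrier P. x \<sqsubseteq>\<^bsub>P\<^esub> y \<longrightarrow> f x \<sqsubseteq>\<^bsub>P\<^esub> f y)"
  by (simp add: Aut_def)

lemma Aut_closed: "f \<in> carrier (Aut P) \<Longrightarrow> x \<in> carrier P \<Longrightarrow> f x \<in> carrier P"
  using Bij_imp_funcset[of f "carrier P"] unfolding carrier_Aut by auto

lemma Aut_mono:
  "\<lbrakk>f \<in> carrier (Aut P); x \<in> carrier P; y \<in> carrier P; x \<sqsubseteq>\<^bsub>P\<^esub> y\<rbrakk> \<Longrightarrow> f x \<sqsubseteq>\<^bsub>P\<^esub> f y"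
  unfolding carrier_Aut by blast

lemma Aut_inj: "\<lbrakk>f \<in> carrier (Aut P); x \<in> carrier P; y \<in> carrier P; f x = f y\<rbrakk> \<Longrightarrow> x = y"
  unfolding carrier_Aut Bij_def bij_betw_def inj_on_def by blast

lemma Aut_surj:
  assumes "f \<in> carrier (Aut P)" "y \<in> carrier P"
  shows "\<exists>x\<in>carrier P. f x = y"
proof -
  have "y \<in> f ` carrier P" using assms by (simp add: carrier_Aut Bij_def bij_betw_def)
  then show ?thesis by blast
qed

lemma Aut_eqI:
  assumes "f \<in> carrier (Aut P)" "g \<in> carrier (Aut P)" "\<And>x. x \<in> carrier P \<Longrightarrow> f x = g x"
  shows "f = g"
  using assms unfolding carrier_Aut by (intro extensionalityI[of f "carrier P" g]) (auto simp: Bij_def)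

lemma carrier_AutI:
  assumes "f \<in> extensional (carrier P)"
    and "\<And>x. x \<in> carrier P \<Longrightarrow> f x \<in> carrier P"
    and "\<And>x y. \<lbrakk>x \<in> carrier P; y \<in> carrier P; f x = f y\<rbrakk> \<Longrightarrow> x = y"
    and "\<And>y. y \<in> carrier P \<Longrightarrow> \<exists>x\<in>carrier P. f x = y"
    and "\<And>x y. \<lbrakk>x \<in> carrier P; y \<in> carrier P; x \<sqsubseteq>\<^bsub>P\<^esub> y\<rbrakk> \<Longrightarrow> f x \<sqsubseteq>\<^bsub>P\<^esub> f y"
  shows "f \<in> carrier (Aut P)"
proof -
  have "inj_on f (carrier P)" using assms(3) by (rule inj_onI)
  moreover have "f ` carrier P = carrier P" using assms(2,4) by (metis image_eqI image_subsetI subsetI subset_antisym)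
  ultimately have "f \<in> Bij (carrier P)" using assms(1) by (simp add: Bij_def bij_betw_def)
  then show ?thesis unfolding carrier_Aut using assms(5) by blast
qed

locale chain = total_order L for L :: "'a gorder" (structure)
begin

definition pmax :: "('a \<Rightarrow> 'a) \<Rightarrow> ('a \<Rightarrow> 'a) \<Rightarrow> 'a \<Rightarrow> 'a" where
  "pmax f g = (\<lambda>x\<in>carrier L. if f x \<sqsubseteq> g x then g x else f x)"

definition pmin :: "('a \<Rightarrow> 'a) \<Rightarrow> ('a \<Rightarrow> 'a) \<Rightarrow> 'a \<Rightarrow> 'a" where
  "pmin f g = (\<lambda>x\<in>carrier L. if f x \<sqsubseteq> g x then f x else g x)"

text \<open>\<open>Aut\<close> asks of a bijection only that it be monotone; on a chain, totality
  and injectivity give the converse. Inverses are therefore automorphisms, and pointwise maxima and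
  minima of automorphisms are injective.\<close>

lemma Aut_reflect:
  assumes "f \<in> carrier (Aut L)" "x \<in> carrier L" "y \<in> carrier L" "f x \<sqsubseteq> f y"
  shows "x \<sqsubseteq> y"
proof (rule ccontr)
  assume n: "\<not> x \<sqsubseteq> y"
  then have "y \<sqsubseteq> x" using assms total_order_total by blast
  then have "f y \<sqsubseteq> f x" using assms Aut_mono by metis
  then have "f x = f y" using assms Aut_closed by (metis le_antisym)
  then have "x = y" using assms Aut_inj by metis
  with n assms show False by simp
qed

text \<open>Monotonicity is inherited pointwise and injectivity follows from reflection of the
  order. For surjectivity, if f u = y = g v, then the smaller of u and v is sent to y: there one map
  takes the value y and the other a value at most y.\<close>

lemma pmax_Aut:
  assumes f: "f \<in> carrier (Aut L)" and g: "g \<in> carrier (Aut L)"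
  shows "pmax f g \<in> carrier (Aut L)"
proof (rule carrier_AutI)
  have cl: "f x \<in> carrier L" "g x \<in> carrier L" if "x \<in> carrier L" for x
    using that f g by (simp_all add: Aut_closed)
  show mono: "pmax f g x \<sqsubseteq> pmax f g y" if "x \<in> carrier L" "y \<in> carrier L" "x \<sqsubseteq> y" for x y
  proof -
    have le: "f x \<sqsubseteq> f y" "g x \<sqsubseteq> g y" using f g that Aut_mono by metis+
    have "f y \<sqsubseteq> pmax f g y" "g y \<sqsubseteq> pmax f g y"
      using that cl total_order_total[of "f y" "g y"] by (auto simp: pmax_def)
    moreover have "pmax f g y \<in> carrier L" using that cl by (simp add: pmax_def)
    ultimately have "f x \<sqsubseteq> pmax f g y" "g x \<sqsubseteq> pmax f g y"
      using le_trans[of "f x" "f y" "pmax f g y"] le_trans[of "g x" "g y" "pmax f g y"] le that cl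
      by simp_all
    moreover have "pmax f g x = f x \<or> pmax f g x = g x" using that by (simp add: pmax_def)
    ultimately show ?thesis by auto
  qed
  show inj: "x = y" if xy: "x \<in> carrier L" "y \<in> carrier L" "pmax f g x = pmax f g y" for x y
  proof -
    have le: "x \<sqsubseteq> y" if "x \<in> carrier L" "y \<in> carrier L" "pmax f g x = pmax f g y" for x y
    proof (rule ccontr)
      assume n: "\<not> x \<sqsubseteq> y"
      have "\<not> f x \<sqsubseteq> f y" "\<not> g x \<sqsubseteq> g y"
        using n Aut_reflect f g that by blast+
      moreover have "f x \<sqsubseteq> pmax f g x" "g x \<sqsubseteq> pmax f g x" "pmax f g y = f y \<or> pmax f g y = g y"
        using that(1,2) cl total_order_total[of "f x" "g x"] by (auto simp: pmax_def)
      ultimately show False using that(3) by auto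
    qed
    show ?thesis using le[of x y] le[of y x] xy by (simp add: le_antisym)
  qed
  show "\<exists>x\<in>carrier L. pmax f g x = y" if y: "y \<in> carrier L" for y
  proof -
    obtain u v where uv: "u \<in> carrier L" "f u = y" "v \<in> carrier L" "g v = y"
      using Aut_surj[OF f y] Aut_surj[OF g y] by blast
    show ?thesis
    proof (cases "u \<sqsubseteq> v")
      case True
      then have "g u \<sqsubseteq> f u" using Aut_mono[OF g uv(1) uv(3)] uv by simp
      then have "pmax f g u = y" using uv cl[OF uv(1)] by (auto simp: pmax_def intro: le_antisym)
      then show ?thesis using uv by blast
    next
      case False
      then have "v \<sqsubseteq> u" using uv total_order_total by blast
      then have "f v \<sqsubseteq> g v" using Aut_mono[OF f uv(3) uv(1)] uv by simp
      then have "pmax f g v = y" using uv by (simp add: pmax_def)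
      then show ?thesis using uv by blast
    qed
  qed
qed (use Aut_closed f g in \<open>auto simp: pmax_def\<close>)

lemma pmin_Aut:
  assumes f: "f \<in> carrier (Aut L)" and g: "g \<in> carrier (Aut L)"
  shows "pmin f g \<in> carrier (Aut L)"
proof (rule carrier_AutI)
  have cl: "f x \<in> carrier L" "g x \<in> carrier L" if "x \<in> carrier L" for x
    using that f g by (simp_all add: Aut_closed)
  show mono: "pmin f g x \<sqsubseteq> pmin f g y" if "x \<in> carrier L" "y \<in> carrier L" "x \<sqsubseteq> y" for x y
  proof -
    have le: "f x \<sqsubseteq> f y" "g x \<sqsubseteq> g y" using f g that Aut_mono by metis+
    have "pmin f g x \<sqsubseteq> f x" "pmin f g x \<sqsubseteq> g x"
      using that cl total_order_total[of "f x" "g x"] by (auto simp: pmin_def)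
    moreover have "pmin f g x \<in> carrier L" using that cl by (simp add: pmin_def)
    ultimately have "pmin f g x \<sqsubseteq> f y" "pmin f g x \<sqsubseteq> g y"
      using le_trans[of "pmin f g x" "f x" "f y"] le_trans[of "pmin f g x" "g x" "g y"] le that cl
      by simp_all
    moreover have "pmin f g y = f y \<or> pmin f g y = g y" using that by (simp add: pmin_def)
    ultimately show ?thesis by auto
  qed
  show inj: "x = y" if xy: "x \<in> carrier L" "y \<in> carrier L" "pmin f g x = pmin f g y" for x y
  proof -
    have le: "x \<sqsubseteq> y" if "x \<in> carrier L" "y \<in> carrier L" "pmin f g x = pmin f g y" for x y
    proof (rule ccontr)
      assume n: "\<not> x \<sqsubseteq> y"
      have "\<not> f x \<sqsubseteq> f y" "\<not> g x \<sqsubseteq> g y"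
        using n Aut_reflect f g that by blast+
      moreover have "pmin f g y \<sqsubseteq> f y" "pmin f g y \<sqsubseteq> g y" "pmin f g x = f x \<or> pmin f g x = g x"
        using that(1,2) cl total_order_total[of "f y" "g y"] by (auto simp: pmin_def)
      ultimately show False using that(3) by auto
    qed
    show ?thesis using le[of x y] le[of y x] xy by (simp add: le_antisym)
  qed
  show "\<exists>x\<in>carrier L. pmin f g x = y" if y: "y \<in> carrier L" for y
  proof -
    obtain u v where uv: "u \<in> carrier L" "f u = y" "v \<in> carrier L" "g v = y"
      using Aut_surj[OF f y] Aut_surj[OF g y] by blast
    show ?thesis
    proof (cases "u \<sqsubseteq> v")
      case True
      then have "f v \<sqsubseteq> f v" "f u \<sqsubseteq> f v" using uv f Aut_mono cl by auto
      then have "g v \<sqsubseteq> f v" using uv by simp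
      then have "pmin f g v = y" using uv cl[OF uv(3)] by (auto simp: pmin_def intro: le_antisym)
      then show ?thesis using uv by blast
    next
      case False
      then have "v \<sqsubseteq> u" using uv total_order_total by blast
      then have "g v \<sqsubseteq> g u" using g uv Aut_mono by metis
      then have "f u \<sqsubseteq> g u" using uv by simp
      then have "pmin f g u = y" using uv by (simp add: pmin_def)
      then show ?thesis using uv by blast
    qed
  qed
qed (use Aut_closed f g in \<open>auto simp: pmin_def\<close>)

lemma group_Aut: "group (Aut L)"
proof (rule groupI)
  show "f \<otimes>\<^bsub>Aut L\<^esub> g \<in> carrier (Aut L)" if "f \<in> carrier (Aut L)" "g \<in> carrier (Aut L)" for f g
    unfolding carrier_Aut
  proof (intro conjI ballI impI)
    show "f \<otimes>\<^bsub>Aut L\<^esub> g \<in> Bij (carrier L)"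
      using that by (simp add: carrier_Aut compose_Bij)
  qed (use that in \<open>simp add: compose_def Aut_mono Aut_closed\<close>)
  show "\<one>\<^bsub>Aut L\<^esub> \<in> carrier (Aut L)" by (simp add: carrier_Aut id_Bij)
  show "f \<otimes>\<^bsub>Aut L\<^esub> g \<otimes>\<^bsub>Aut L\<^esub> k = f \<otimes>\<^bsub>Aut L\<^esub> (g \<otimes>\<^bsub>Aut L\<^esub> k)"
    if "f \<in> carrier (Aut L)" "g \<in> carrier (Aut L)" "k \<in> carrier (Aut L)" for f g k
    using that by (auto simp: compose_def Aut_closed)
  show "\<one>\<^bsub>Aut L\<^esub> \<otimes>\<^bsub>Aut L\<^esub> f = f" if "f \<in> carrier (Aut L)" for f
  proof -
    have "f \<in> extensional (carrier L)" using that by (simp add: carrier_Aut Bij_def)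
    then show ?thesis by (auto simp: compose_def extensional_def)
  qed
  show "\<exists>g\<in>carrier (Aut L). g \<otimes>\<^bsub>Aut L\<^esub> f = \<one>\<^bsub>Aut L\<^esub>" if f: "f \<in> carrier (Aut L)" for f
  proof (rule bexI)
    let ?g = "\<lambda>x\<in>carrier L. (inv_into (carrier L) f) x"
    have fB: "f \<in> Bij (carrier L)" using f by (simp add: carrier_Aut)
    have fg: "f (?g x) = x" if "x \<in> carrier L" for x
      using fB that by (simp add: Bij_def bij_betw_def f_inv_into_f)
    have gcl: "?g x \<in> carrier L" if "x \<in> carrier L" for x
      using fB that by (simp add: Bij_def bij_betw_def inv_into_into)
    show "?g \<otimes>\<^bsub>Aut L\<^esub> f = \<one>\<^bsub>Aut L\<^esub>" using fg by (auto simp: compose_def)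
    show "?g \<in> carrier (Aut L)"
      unfolding carrier_Aut
    proof (intro conjI ballI impI)
      show "?g \<in> Bij (carrier L)" using fB by (rule restrict_inv_into_Bij)
      show "?g x \<sqsubseteq> ?g y" if "x \<in> carrier L" "y \<in> carrier L" "x \<sqsubseteq> y" for x y
        by (rule Aut_reflect[OF f gcl gcl]) (use that fg in metis)+
    qed
  qed
qed

lemma po_group_Aut: "po_group (Aut L)"
proof (rule po_groupI[OF group_Aut])
  fix f g assume "f \<in> carrier (Aut L)" "g \<in> carrier (Aut L)" "f \<preceq>\<^bsub>Aut L\<^esub> g" "g \<preceq>\<^bsub>Aut L\<^esub> f"
  then show "f = g" by (intro Aut_eqI) (auto simp: Aut_closed le_antisym)
next
  fix f g k assume "f \<in> carrier (Aut L)" "g \<in> carrier (Aut L)" "k \<in> carrier (Aut L)"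
    "f \<preceq>\<^bsub>Aut L\<^esub> g" "g \<preceq>\<^bsub>Aut L\<^esub> k"
  then show "f \<preceq>\<^bsub>Aut L\<^esub> k" using le_trans by (simp add: Aut_closed) (meson Aut_closed)
next
  fix a b s t assume "a \<in> carrier (Aut L)" "b \<in> carrier (Aut L)" "s \<in> carrier (Aut L)"
    "t \<in> carrier (Aut L)" "a \<preceq>\<^bsub>Aut L\<^esub> b"
  then show "s \<otimes>\<^bsub>Aut L\<^esub> a \<otimes>\<^bsub>Aut L\<^esub> t \<preceq>\<^bsub>Aut L\<^esub> s \<otimes>\<^bsub>Aut L\<^esub> b \<otimes>\<^bsub>Aut L\<^esub> t"
    by (simp add: compose_def Aut_closed Aut_mono)
qed (simp add: Aut_closed)

lemma is_ljoin_pmax: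
  assumes "f \<in> carrier (Aut L)" "g \<in> carrier (Aut L)"
  shows "is_ljoin (Aut L) f g (pmax f g)"
proof -
  have "f x \<in> carrier L" "g x \<in> carrier L" if "x \<in> carrier L" for x
    using that assms by (simp_all add: Aut_closed)
  moreover from this have nle: "g x \<sqsubseteq> f x" if "x \<in> carrier L" "\<not> f x \<sqsubseteq> g x" for x
    using that total_order_total by blast
  ultimately show ?thesis
    unfolding is_ljoin_def using pmax_Aut[OF assms] nle by (auto simp: pmax_def)
qed

lemma is_lmeet_pmin:
  assumes "f \<in> carrier (Aut L)" "g \<in> carrier (Aut L)"
  shows "is_lmeet (Aut L) f g (pmin f g)"
proof -
  have "f x \<in> carrier L" "g x \<in> carrier L" if "x \<in> carrier L" for x
    using that assms by (simp_all add: Aut_closed)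
  moreover from this have nle: "g x \<sqsubseteq> f x" if "x \<in> carrier L" "\<not> f x \<sqsubseteq> g x" for x
    using that total_order_total by blast
  ultimately show ?thesis
    unfolding is_lmeet_def using pmin_Aut[OF assms] nle by (auto simp: pmin_def)
qed

lemma lgroup_Aut: "lgroup (Aut L)"
  by (rule lgroupI[OF po_group_Aut]) (use is_ljoin_pmax is_lmeet_pmin in blast)+

lemma ljoin_Aut: "\<lbrakk>f \<in> carrier (Aut L); g \<in> carrier (Aut L)\<rbrakk> \<Longrightarrow> ljoin (Aut L) f g = pmax f g"
  by (rule po_group.ljoin_eq[OF po_group_Aut]) (auto intro: is_ljoin_pmax)

end

section \<open>Lattice-subgroups generated by a set\<close>

lemma lsubgroup_lsubgroup_generated:
  assumes "lgroup L" "S \<subseteq> carrier L"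
  shows "lsubgroup (lsubgroup_generated L S) L"
proof -
  interpret lgroup L by fact
  \<comment> \<open>The intersection must run over a nonempty family; the whole carrier is a
    member.\<close>
  have "lsubgroup (carrier L) L"
    unfolding lsubgroup_def using is_ljoin_ljoin is_lmeet_lmeet subgroup_self
    by (auto simp: is_ljoin_def is_lmeet_def)
  then have "subgroup (lsubgroup_generated L S) L"
    unfolding lsubgroup_generated_def using assms
    by (intro subgroups_Inter) (auto simp: lsubgroup_def)
  then show ?thesis
    unfolding lsubgroup_def lsubgroup_generated_def by auto
qed

lemma lsubgroup_generated_eq:
  assumes "lsubgroup S L"
  shows "lsubgroup_generated L S = S"
  using assms unfolding lsubgroup_generated_def by auto

lemma lgroup_embedding_lsubgroup:
  assumes "lgroup L" "lsubgroup H L"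
  shows "lgroup_embedding (L\<lparr>carrier := H\<rparr>) L (\<lambda>x. x)"
proof -
  have "subgroup H L" using assms by (simp add: lsubgroup_def)
  then show ?thesis
    using assms by (auto intro!: lgroup_embedding.intro lgroup_embedding_axioms.intro
      simp: subgroup.m_closed subgroup.one_closed)
qed

subsection \<open>The lattice-ordered group of a pre-cone\<close>

lemma mem_beta_iff:
  fixes G :: "'a ogroup" (structure)
  assumes "group G" and C: "C \<subseteq> carrier G"
  shows "x \<in> beta G C \<longleftrightarrow> x \<in> carrier G \<and> (\<forall>t\<in>carrier G. t \<otimes> x \<otimes> inv t \<in> C)"
proof -
  interpret group G by fact
  have *: "x \<in> inv t <# C #> t \<longleftrightarrow> x \<in> carrier G \<and> t \<otimes> x \<otimes> inv t \<in> C" if t: "t \<in> carrier G" for t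
  proof
    assume "x \<in> inv t <# C #> t"
    then obtain c where c: "c \<in> C" "x = inv t \<otimes> c \<otimes> t"
      by (auto simp: l_coset_def r_coset_def)
    then have "c \<in> carrier G" using C by blast
    then show "x \<in> carrier G \<and> t \<otimes> x \<otimes> inv t \<in> C"
      using c t by (simp add: m_assoc[symmetric])  (simp add: m_assoc)
  next
    assume x: "x \<in> carrier G \<and> t \<otimes> x \<otimes> inv t \<in> C"
    have "inv t \<otimes> (t \<otimes> x \<otimes> inv t) \<otimes> t = x"
      using x t by (simp add: m_assoc inv_solve_left')
    then show "x \<in> inv t <# C #> t"
      using x t unfolding l_coset_def r_coset_def by force
  qed
  show ?thesis
    unfolding beta_def using * one_closed by blast
qed

text \<open>The algebraic part of the pre-cone axioms, with properness and positivity stated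
  separately. The whole group is an instance, and so is the core beta(C) once it is total.\<close>

locale total_submonoid = group G for G :: "'a ogroup" (structure) +
  fixes C
  assumes C_sub: "C \<subseteq> carrier G"
    and C_one: "\<one> \<in> C"
    and C_mult: "\<lbrakk>a \<in> C; b \<in> C\<rbrakk> \<Longrightarrow> a \<otimes> b \<in> C"
    and C_total: "a \<in> carrier G \<Longrightarrow> a \<in> C \<or> inv a \<in> C"
begin

lemma rel_iff: "(a, b) \<in> precone_rel G C \<longleftrightarrow> a \<in> carrier G \<and> b \<in> carrier G \<and> b \<otimes> inv a \<in> C"
  by (simp add: precone_rel_def)

lemma rel_refl: "a \<in> carrier G \<Longrightarrow> (a, a) \<in> precone_rel G C"
  by (simp add: rel_iff C_one)

lemma rel_trans: "\<lbrakk>(a, b) \<in> precone_rel G C; (b, c) \<in> precone_rel G C\<rbrakk> \<Longrightarrow> (a, c) \<in> precone_rel G C"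
proof -
  assume h: "(a, b) \<in> precone_rel G C" "(b, c) \<in> precone_rel G C"
  then have "(c \<otimes> inv b) \<otimes> (b \<otimes> inv a) \<in> C" using C_mult by (simp add: rel_iff)
  also have "(c \<otimes> inv b) \<otimes> (b \<otimes> inv a) = c \<otimes> inv a"
    using h by (simp add: rel_iff m_assoc) (simp add: m_assoc[symmetric])
  finally show ?thesis using h by (simp add: rel_iff)
qed

lemma rel_total:
  assumes "a \<in> carrier G" "b \<in> carrier G"
  shows "(a, b) \<in> precone_rel G C \<or> (b, a) \<in> precone_rel G C"
  using C_total[of "b \<otimes> inv a"] assms by (simp add: rel_iff inv_mult_group)

lemma rel_right:
  assumes "(a, b) \<in> precone_rel G C" "t \<in> carrier G"
  shows "(a \<otimes> t, b \<otimes> t) \<in> precone_rel G C"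
proof -
  have "b \<otimes> t \<otimes> inv (a \<otimes> t) = b \<otimes> inv a"
    using assms by (simp add: rel_iff inv_mult_group m_assoc) (simp add: m_assoc[symmetric])
  then show ?thesis using assms by (simp add: rel_iff)
qed

abbreviation cls :: "'a \<Rightarrow> 'a set" where
  "cls a \<equiv> equiv_rel G C `` {a}"

lemma equiv_rel_iff: "(a, b) \<in> equiv_rel G C \<longleftrightarrow> (a, b) \<in> precone_rel G C \<and> (b, a) \<in> precone_rel G C"
  by (auto simp: equiv_rel_def)

lemma equiv: "equiv (carrier G) (equiv_rel G C)"
proof (rule equivI)
  show "equiv_rel G C \<subseteq> carrier G \<times> carrier G" by (auto simp: equiv_rel_iff rel_iff)
  show "refl_on (carrier G) (equiv_rel G C)" by (auto simp: refl_on_def equiv_rel_iff rel_refl)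
  show "sym (equiv_rel G C)" by (auto simp: sym_def equiv_rel_iff)
  show "trans (equiv_rel G C)" unfolding trans_def equiv_rel_iff by (blast intro: rel_trans)
qed

lemma carrier_Omega: "carrier (Omega G C) = cls ` carrier G"
  by (auto simp: Omega_def quotient_def)

lemma cls_in_Omega: "a \<in> carrier G \<Longrightarrow> cls a \<in> carrier (Omega G C)"
  by (simp add: carrier_Omega)

lemma cls_eq_iff: "\<lbrakk>a \<in> carrier G; b \<in> carrier G\<rbrakk> \<Longrightarrow>
    cls a = cls b \<longleftrightarrow> (a, b) \<in> precone_rel G C \<and> (b, a) \<in> precone_rel G C"
  using eq_equiv_class_iff[OF equiv] by (simp add: equiv_rel_iff)

lemma cls_le_iff:
  assumes "a \<in> carrier G" "b \<in> carrier G"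
  shows "cls a \<sqsubseteq>\<^bsub>Omega G C\<^esub> cls b \<longleftrightarrow> (a, b) \<in> precone_rel G C"
proof -
  have "cls a \<sqsubseteq>\<^bsub>Omega G C\<^esub> cls b \<longleftrightarrow>
      (\<exists>x y. (a, x) \<in> equiv_rel G C \<and> (b, y) \<in> equiv_rel G C \<and> (x, y) \<in> precone_rel G C)"
    by (auto simp: Omega_def)
  also have "\<dots> \<longleftrightarrow> (a, b) \<in> precone_rel G C"
    using assms rel_refl unfolding equiv_rel_iff by (blast intro: rel_trans)
  finally show ?thesis .
qed

lemma eq_Omega: "eq (Omega G C) = (=)"
  by (simp add: Omega_def)

sublocale chain "Omega G C"
proof -
  have cl: "\<exists>a. a \<in> carrier G \<and> X = cls a" if "X \<in> carrier (Omega G C)" for X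
    using that by (auto simp: carrier_Omega)
  have refl: "X \<sqsubseteq>\<^bsub>Omega G C\<^esub> X" if "X \<in> carrier (Omega G C)" for X
    using cl[OF that] rel_refl by (auto simp: cls_le_iff)
  have anti: "X = Y" if "X \<in> carrier (Omega G C)" "Y \<in> carrier (Omega G C)"
    "X \<sqsubseteq>\<^bsub>Omega G C\<^esub> Y" "Y \<sqsubseteq>\<^bsub>Omega G C\<^esub> X" for X Y
  proof -
    obtain a b where "a \<in> carrier G" "X = cls a" "b \<in> carrier G" "Y = cls b"
      using cl \<open>X \<in> _\<close> \<open>Y \<in> _\<close> by blast
    then show ?thesis using that(3,4) by (simp add: cls_le_iff cls_eq_iff)
  qed
  have tr: "X \<sqsubseteq>\<^bsub>Omega G C\<^esub> Z" if "X \<in> carrier (Omega G C)" "Y \<in> carrier (Omega G C)"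
    "Z \<in> carrier (Omega G C)" "X \<sqsubseteq>\<^bsub>Omega G C\<^esub> Y" "Y \<sqsubseteq>\<^bsub>Omega G C\<^esub> Z" for X Y Z
    using cl[OF that(1)] cl[OF that(2)] cl[OF that(3)] that(4,5)
    by (auto simp: cls_le_iff intro: rel_trans)
  have total: "X \<sqsubseteq>\<^bsub>Omega G C\<^esub> Y \<or> Y \<sqsubseteq>\<^bsub>Omega G C\<^esub> X"
    if "X \<in> carrier (Omega G C)" "Y \<in> carrier (Omega G C)" for X Y
  proof -
    obtain a b where "a \<in> carrier G" "X = cls a" "b \<in> carrier G" "Y = cls b"
      using cl \<open>X \<in> _\<close> \<open>Y \<in> _\<close> by blast
    then show ?thesis using rel_total[of a b] by (simp add: cls_le_iff)
  qed
  show "chain (Omega G C)"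
    unfolding chain_def
  proof unfold_locales
    show "X \<sqsubseteq>\<^bsub>Omega G C\<^esub> Z" if "X \<sqsubseteq>\<^bsub>Omega G C\<^esub> Y" "Y \<sqsubseteq>\<^bsub>Omega G C\<^esub> Z" "X \<in> carrier (Omega G C)"
      "Y \<in> carrier (Omega G C)" "Z \<in> carrier (Omega G C)" for X Y Z
      using tr[OF that(3-5) that(1,2)] .
    show "X .=\<^bsub>Omega G C\<^esub> Y" if "X \<sqsubseteq>\<^bsub>Omega G C\<^esub> Y" "Y \<sqsubseteq>\<^bsub>Omega G C\<^esub> X"
      "X \<in> carrier (Omega G C)" "Y \<in> carrier (Omega G C)" for X Y
      using anti[OF that(3,4,1,2)] by (simp add: eq_Omega)
    show "X \<sqsubseteq>\<^bsub>Omega G C\<^esub> X" if "X \<in> carrier (Omega G C)" for X using refl[OF that] .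
    show "X \<sqsubseteq>\<^bsub>Omega G C\<^esub> Y \<or> Y \<sqsubseteq>\<^bsub>Omega G C\<^esub> X"
      if "X \<in> carrier (Omega G C)" "Y \<in> carrier (Omega G C)" for X Y using total[OF that] .
  qed (simp_all add: eq_Omega)
qed

text \<open>Right invariance makes the class of x a independent of the representative x, so the
  union in the definition is over a constant family.\<close>

lemma R_map_cls:
  assumes a: "a \<in> carrier G" and b: "b \<in> carrier G"
  shows "R_map G C a (cls b) = cls (b \<otimes> a)"
proof -
  have *: "\<forall>x\<in>cls b. cls (x \<otimes> a) = cls (b \<otimes> a)"
  proof
    fix x assume "x \<in> cls b"
    then have "(b, x) \<in> precone_rel G C" "(x, b) \<in> precone_rel G C" "x \<in> carrier G"
      by (simp_all add: equiv_rel_iff rel_iff)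
    then show "cls (x \<otimes> a) = cls (b \<otimes> a)"
      using a b rel_right by (simp add: cls_eq_iff)
  qed
  have "b \<in> cls b" using b by (simp add: equiv_rel_iff rel_refl)
  from UN_constant_eq[OF this *] show ?thesis
    unfolding R_map_def using cls_in_Omega[OF b] by simp
qed

lemma R_map_Aut:
  assumes a: "a \<in> carrier G"
  shows "R_map G C a \<in> carrier (Aut (Omega G C))"
proof (rule carrier_AutI)
  show "R_map G C a \<in> extensional (carrier (Omega G C))" by (simp add: R_map_def)
  have cancel: "x \<otimes> a \<otimes> inv a = x" "x \<otimes> inv a \<otimes> a = x" if "x \<in> carrier G" for x
    using that a by (simp_all add: m_assoc)
  show "R_map G C a X \<in> carrier (Omega G C)" if "X \<in> carrier (Omega G C)" for X
    using that a by (auto simp: carrier_Omega R_map_cls)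
  show "X = Y" if XY: "X \<in> carrier (Omega G C)" "Y \<in> carrier (Omega G C)"
    "R_map G C a X = R_map G C a Y" for X Y
  proof -
    obtain x y where xy: "x \<in> carrier G" "X = cls x" "y \<in> carrier G" "Y = cls y"
      using XY by (auto simp: carrier_Omega)
    have "R_map G C (inv a) (R_map G C a X) = R_map G C (inv a) (R_map G C a Y)"
      using XY by simp
    then show ?thesis using xy a by (simp add: R_map_cls cancel)
  qed
  show "\<exists>X\<in>carrier (Omega G C). R_map G C a X = Y" if Y: "Y \<in> carrier (Omega G C)" for Y
  proof -
    obtain y where y: "y \<in> carrier G" "Y = cls y" using Y by (auto simp: carrier_Omega)
    have "R_map G C a (cls (y \<otimes> inv a)) = Y" using y a by (simp add: R_map_cls cancel)
    then show ?thesis using y a cls_in_Omega[of "y \<otimes> inv a"] by blast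
  qed
  show "R_map G C a X \<sqsubseteq>\<^bsub>Omega G C\<^esub> R_map G C a Y"
    if "X \<in> carrier (Omega G C)" "Y \<in> carrier (Omega G C)" "X \<sqsubseteq>\<^bsub>Omega G C\<^esub> Y" for X Y
    using that a by (auto simp: carrier_Omega R_map_cls cls_le_iff rel_right)
qed

text \<open>The class of x moves to that of x a and then to that of x a b. With the product read as
  "second after first", right translation is a homomorphism and not an anti-homomorphism.\<close>

lemma R_map_mult:
  assumes "a \<in> carrier G" "b \<in> carrier G"
  shows "R_map G C (a \<otimes> b) = R_map G C a \<otimes>\<^bsub>Aut (Omega G C)\<^esub> R_map G C b"
proof (rule Aut_eqI)
  show "R_map G C a \<otimes>\<^bsub>Aut (Omega G C)\<^esub> R_map G C b \<in> carrier (Aut (Omega G C))"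
    using assms group.is_monoid[OF group_Aut] R_map_Aut by (meson monoid.m_closed)
  show "R_map G C (a \<otimes> b) X = (R_map G C a \<otimes>\<^bsub>Aut (Omega G C)\<^esub> R_map G C b) X"
    if "X \<in> carrier (Omega G C)" for X
    using that assms by (auto simp: carrier_Omega R_map_cls compose_def m_assoc)
qed (use assms R_map_Aut in simp)

lemma R_map_hom: "R_map G C \<in> hom G (Aut (Omega G C))"
  by (auto simp: hom_def R_map_Aut R_map_mult simp del: Aut_simps)

lemma R_map_group_hom: "group_hom G (Aut (Omega G C)) (R_map G C)"
  by (intro group_hom.intro group_hom_axioms.intro is_group group_Aut R_map_hom)

text \<open>At the class of x the comparison says that x b (x a)^-1 = x (b a^-1) x^-1 lies in C.
  Letting x range over G yields the intersection of the conjugates, so beta(C) is the positive cone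
  that the pointwise order induces on G.\<close>

lemma R_map_le_iff:
  assumes a: "a \<in> carrier G" and b: "b \<in> carrier G"
  shows "R_map G C a \<preceq>\<^bsub>Aut (Omega G C)\<^esub> R_map G C b \<longleftrightarrow> b \<otimes> inv a \<in> beta G C"
proof -
  have eq: "x \<otimes> b \<otimes> inv (x \<otimes> a) = x \<otimes> (b \<otimes> inv a) \<otimes> inv x" if "x \<in> carrier G" for x
    using that a b by (simp add: inv_mult_group m_assoc)
  have "R_map G C a \<preceq>\<^bsub>Aut (Omega G C)\<^esub> R_map G C b \<longleftrightarrow>
      (\<forall>x\<in>carrier G. (x \<otimes> a, x \<otimes> b) \<in> precone_rel G C)"
    using a b by (auto simp: carrier_Omega R_map_cls cls_le_iff)
  also have "\<dots> \<longleftrightarrow> b \<otimes> inv a \<in> beta G C"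
    using a b eq by (auto simp: rel_iff mem_beta_iff[OF is_group C_sub])
  finally show ?thesis .
qed

lemma lsubgroup_H:
  "lsubgroup (lsubgroup_generated (Aut (Omega G C)) (R_map G C ` carrier G)) (Aut (Omega G C))"
  using R_map_Aut by (intro lsubgroup_lsubgroup_generated lgroup_Aut) blast

lemma embedding_H: "lgroup_embedding (H_lgroup G C) (Aut (Omega G C)) (\<lambda>x. x)"
  unfolding H_lgroup_def using lgroup_Aut lsubgroup_H by (rule lgroup_embedding_lsubgroup)

text \<open>Evaluate the defining inequality of representability at the class of \<open>s\<close>, with \<open>a\<close> and
  \<open>t\<inverse> s\<close> substituted for its variables: it fails there if \<open>a\<close> lowers \<open>s\<close> and \<open>a\<inverse>\<close> lowers \<open>t\<close>.\<close>

lemma beta_total: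
  assumes V: "representable_variety V" "in_variety (H_lgroup G C) V" and a: "a \<in> carrier G"
  shows "a \<in> beta G C \<or> inv a \<in> beta G C"
proof (rule ccontr)
  assume "\<not> ?thesis"
  then obtain s t where s: "s \<in> carrier G" "s \<otimes> a \<otimes> inv s \<notin> C"
    and t: "t \<in> carrier G" "t \<otimes> inv a \<otimes> inv t \<notin> C"
    using a by (auto simp: mem_beta_iff[OF is_group C_sub])
  let ?A = "Aut (Omega G C)"
  let ?R = "R_map G C"
  let ?H = "H_lgroup G C"
  interpret E: lgroup_embedding ?H ?A "\<lambda>x. x" by (rule embedding_H)
  interpret R: group_hom G ?A ?R by (rule R_map_group_hom)
  \<comment> \<open>Since s b^-1 = t, the element \<open>w\<close> acts on the class of s as a^-1
    acts on the class of t, followed by the translation that carries t back to s.\<close>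
  define b where "b = inv t \<otimes> s"
  define w where "w = inv b \<otimes> inv a \<otimes> b"
  have b: "b \<in> carrier G" and w: "w \<in> carrier G" using s t a by (simp_all add: b_def w_def)
  have RH: "?R x \<in> carrier ?H" if "x \<in> carrier G" for x
    using that by (auto simp: H_lgroup_def lsubgroup_generated_def)
  have H_mult: "f \<otimes>\<^bsub>?H\<^esub> g = f \<otimes>\<^bsub>?A\<^esub> g" for f g
    by (simp add: H_lgroup_def del: Aut_simps)
  have Rw: "inv\<^bsub>?H\<^esub> ?R b \<otimes>\<^bsub>?H\<^esub> inv\<^bsub>?H\<^esub> ?R a \<otimes>\<^bsub>?H\<^esub> ?R b = ?R w"
    using a b RH E.h_inv by (simp add: w_def H_mult del: Aut_simps)
  have j: "ljoin ?H (?R a) (?R w) = pmax (?R a) (?R w)"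
    using E.h_ljoin[OF RH[OF a] RH[OF w]] ljoin_Aut[OF R_map_Aut[OF a] R_map_Aut[OF w]] by simp
  have "\<one>\<^bsub>?H\<^esub> \<preceq>\<^bsub>?H\<^esub> pmax (?R a) (?R w)"
  proof -
    have cl: "pmax (?R a) (?R w) \<in> carrier ?H"
      using E.K.is_ljoin_ljoin[OF RH[OF a] RH[OF w]] j by (simp add: is_ljoin_def)
    have "ljoin ?H \<one>\<^bsub>?H\<^esub> (pmax (?R a) (?R w)) = pmax (?R a) (?R w)"
      using representable_variety_identity[OF V RH[OF a] RH[OF b]] unfolding Rw j .
    then show ?thesis
      using E.K.is_ljoin_ljoin[OF E.K.one_closed cl] by (simp add: is_ljoin_def)
  qed
  then have le: "cls s \<sqsubseteq>\<^bsub>Omega G C\<^esub> pmax (?R a) (?R w) (cls s)"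
    using s cls_in_Omega[of s] by (simp add: H_lgroup_def)
  moreover have "pmax (?R a) (?R w) (cls s) = cls (s \<otimes> a) \<or> pmax (?R a) (?R w) (cls s) = cls (s \<otimes> w)"
    using s a w by (simp add: pmax_def cls_in_Omega R_map_cls)
  ultimately have "(s, s \<otimes> a) \<in> precone_rel G C \<or> (s, s \<otimes> w) \<in> precone_rel G C"
    using s a w by (metis cls_le_iff m_closed)
  moreover have "s \<otimes> w \<otimes> inv s = t \<otimes> inv a \<otimes> inv t"
  proof -
    have "s \<otimes> w = t \<otimes> inv a \<otimes> inv t \<otimes> s"
      using s t a by (simp add: w_def b_def inv_mult_group m_assoc[symmetric])
    then show ?thesis using s t a by (simp add: m_assoc)
  qed
  ultimately show False using s t by (simp add: rel_iff)
qed

end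

text \<open>The value of a term at elements of \<open>G\<close>, with joins and meets taken for the total pre-order
  given by \<open>B\<close>.\<close>

primrec gval :: "('a, 'b) monoid_scheme \<Rightarrow> 'a set \<Rightarrow> (nat \<Rightarrow> 'a) \<Rightarrow> lterm \<Rightarrow> 'a" where
  "gval G B \<rho> (Var n) = \<rho> n"
| "gval G B \<rho> One = \<one>\<^bsub>G\<^esub>"
| "gval G B \<rho> (Inv s) = inv\<^bsub>G\<^esub> (gval G B \<rho> s)"
| "gval G B \<rho> (Mult s t) = gval G B \<rho> s \<otimes>\<^bsub>G\<^esub> gval G B \<rho> t"
| "gval G B \<rho> (Join s t) =
     (if gval G B \<rho> t \<otimes>\<^bsub>G\<^esub> inv\<^bsub>G\<^esub> (gval G B \<rho> s) \<in> B then gval G B \<rho> t else gval G B \<rho> s)"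
| "gval G B \<rho> (Meet s t) =
     (if gval G B \<rho> t \<otimes>\<^bsub>G\<^esub> inv\<^bsub>G\<^esub> (gval G B \<rho> s) \<in> B then gval G B \<rho> s else gval G B \<rho> t)"

definition satisfies :: "('a, 'b) monoid_scheme \<Rightarrow> 'a set \<Rightarrow> (lterm \<times> lterm) set \<Rightarrow> bool" where
  "satisfies G B V \<longleftrightarrow> (\<forall>(s, t)\<in>V. \<forall>\<rho>. range \<rho> \<subseteq> carrier G \<longrightarrow>
     gval G B \<rho> s \<otimes>\<^bsub>G\<^esub> inv\<^bsub>G\<^esub> (gval G B \<rho> t) \<in> B \<and> gval G B \<rho> t \<otimes>\<^bsub>G\<^esub> inv\<^bsub>G\<^esub> (gval G B \<rho> s) \<in> B)"

lemma (in group) gval_closed: "range \<rho> \<subseteq> carrier G \<Longrightarrow> gval G B \<rho> s \<in> carrier G"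
  by (induction s) auto

context total_submonoid
begin

lemma mem_beta: "x \<in> beta G C \<longleftrightarrow> x \<in> carrier G \<and> (\<forall>t\<in>carrier G. t \<otimes> x \<otimes> inv t \<in> C)"
  by (rule mem_beta_iff[OF is_group C_sub])

lemma beta_sub: "beta G C \<subseteq> C"
proof
  fix x assume "x \<in> beta G C"
  then have "x \<in> carrier G" "\<one> \<otimes> x \<otimes> inv \<one> \<in> C" using mem_beta one_closed by blast+
  then show "x \<in> C" by simp
qed

lemma beta_one: "\<one> \<in> beta G C"
  by (simp add: mem_beta C_one)

lemma beta_mult:
  assumes "a \<in> beta G C" "b \<in> beta G C"
  shows "a \<otimes> b \<in> beta G C"
proof -
  have cl: "a \<in> carrier G" "b \<in> carrier G" using assms by (simp_all add: mem_beta)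
  have "t \<otimes> (a \<otimes> b) \<otimes> inv t \<in> C" if t: "t \<in> carrier G" for t
  proof -
    have "(t \<otimes> a \<otimes> inv t) \<otimes> (t \<otimes> b \<otimes> inv t) \<in> C" using assms t by (simp add: mem_beta C_mult)
    also have "(t \<otimes> a \<otimes> inv t) \<otimes> (t \<otimes> b \<otimes> inv t) = t \<otimes> (a \<otimes> b) \<otimes> inv t"
      using cl t by (simp add: m_assoc inv_solve_left')
    finally show ?thesis .
  qed
  with cl show ?thesis by (simp add: mem_beta)
qed

lemma beta_conj:
  assumes "a \<in> beta G C" "s \<in> carrier G"
  shows "s \<otimes> a \<otimes> inv s \<in> beta G C"
proof -
  have a: "a \<in> carrier G" using assms by (simp add: mem_beta)
  have "t \<otimes> (s \<otimes> a \<otimes> inv s) \<otimes> inv t \<in> C" if t: "t \<in> carrier G" for t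
  proof -
    have "(t \<otimes> s) \<otimes> a \<otimes> inv (t \<otimes> s) \<in> C" using assms t by (simp add: mem_beta)
    then show ?thesis using assms t a by (simp add: m_assoc inv_mult_group)
  qed
  then show ?thesis using a assms by (simp add: mem_beta)
qed

section \<open>Pre-cones whose core beta(C) is total\<close>

context
  assumes beta_tot: "\<And>a. a \<in> carrier G \<Longrightarrow> a \<in> beta G C \<or> inv a \<in> beta G C"
begin

lemma total_submonoid_beta: "total_submonoid G (beta G C)"
  using beta_sub C_sub beta_one beta_mult beta_tot by unfold_locales auto

lemma R_map_le_total:
  assumes "a \<in> carrier G" "b \<in> carrier G" "b \<otimes> inv a \<notin> beta G C"
  shows "R_map G C b \<preceq>\<^bsub>Aut (Omega G C)\<^esub> R_map G C a"
proof -
  have "inv (b \<otimes> inv a) \<in> beta G C" using beta_tot assms by blast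
  then have "a \<otimes> inv b \<in> beta G C" using assms by (simp add: inv_mult_group)
  then show ?thesis using assms R_map_le_iff by blast
qed

text \<open>The two images are comparable, so their join is the larger one; in case of a tie they
  coincide. The case distinction is the one in \<open>gval\<close>.\<close>

lemma ljoin_R_map:
  assumes a: "a \<in> carrier G" and b: "b \<in> carrier G"
  shows "ljoin (Aut (Omega G C)) (R_map G C a) (R_map G C b) =
    R_map G C (if b \<otimes> inv a \<in> beta G C then b else a)"
  using a b R_map_le_total[OF a b] R_map_le_iff[OF a b] po_group.leq_refl[OF po_group_Aut] R_map_Aut
  by (intro po_group.ljoin_eq[OF po_group_Aut]) (auto simp: is_ljoin_def simp del: Aut_simps)

lemma lmeet_R_map:
  assumes a: "a \<in> carrier G" and b: "b \<in> carrier G"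
  shows "lmeet (Aut (Omega G C)) (R_map G C a) (R_map G C b) =
    R_map G C (if b \<otimes> inv a \<in> beta G C then a else b)"
  using a b R_map_le_total[OF a b] R_map_le_iff[OF a b] po_group.leq_refl[OF po_group_Aut] R_map_Aut
  by (intro po_group.lmeet_eq[OF po_group_Aut]) (auto simp: is_lmeet_def simp del: Aut_simps)

lemma carrier_H: "carrier (H_lgroup G C) = R_map G C ` carrier G"
proof -
  interpret R: group_hom G "Aut (Omega G C)" "R_map G C" by (rule R_map_group_hom)
  have "subgroup (R_map G C ` carrier G) (Aut (Omega G C))" by (rule R.img_is_subgroup)
  then have "lsubgroup (R_map G C ` carrier G) (Aut (Omega G C))"
    unfolding lsubgroup_def by (auto simp: ljoin_R_map lmeet_R_map)
  then show ?thesis by (simp add: H_lgroup_def lsubgroup_generated_eq)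
qed

lemma lterm_val_H:
  assumes "range \<rho> \<subseteq> carrier G"
  shows "lterm_val (H_lgroup G C) (R_map G C \<circ> \<rho>) s = R_map G C (gval G (beta G C) \<rho> s)"
proof -
  interpret E: lgroup_embedding "H_lgroup G C" "Aut (Omega G C)" "\<lambda>x. x" by (rule embedding_H)
  interpret R: group_hom G "Aut (Omega G C)" "R_map G C" by (rule R_map_group_hom)
  \<comment> \<open>Evaluation is moved from H_C to the full automorphism group, where
    \<open>R_map\<close> is known to be a homomorphism and the joins and meets of its values have
    been computed.\<close>
  have "range (R_map G C \<circ> \<rho>) \<subseteq> carrier (H_lgroup G C)"
    using assms unfolding carrier_H by auto
  then have "lterm_val (H_lgroup G C) (R_map G C \<circ> \<rho>) s =
      lterm_val (Aut (Omega G C)) (R_map G C \<circ> \<rho>) s"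
    using E.h_lterm_val by (simp add: comp_def)
  also have "\<dots> = R_map G C (gval G (beta G C) \<rho> s)"
    by (induction s)
      (simp_all add: ljoin_R_map lmeet_R_map gval_closed[OF assms] del: Aut_simps)
  finally show ?thesis .
qed

text \<open>Every assignment into H_C lifts to G because \<open>R_map\<close> is onto H_C, and two
  elements of G have the same image iff both of their quotients lie in beta(C). This turns an
  identity of H_C into the membership conditions of \<open>satisfies\<close>.\<close>

lemma in_variety_H_iff: "in_variety (H_lgroup G C) V \<longleftrightarrow> satisfies G (beta G C) V"
proof -
  interpret E: lgroup_embedding "H_lgroup G C" "Aut (Omega G C)" "\<lambda>x. x" by (rule embedding_H)
  have eq: "R_map G C a = R_map G C b \<longleftrightarrow> a \<otimes> inv b \<in> beta G C \<and> b \<otimes> inv a \<in> beta G C"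
    if "a \<in> carrier G" "b \<in> carrier G" for a b
    using R_map_le_iff[OF that] R_map_le_iff[OF that(2,1)] R_map_Aut that
      po_group.leq_refl[OF po_group_Aut] po_group.leq_antisym[OF po_group_Aut] by metis
  have lift: "(\<forall>\<sigma>. range \<sigma> \<subseteq> R_map G C ` carrier G \<longrightarrow> P \<sigma>) \<longleftrightarrow>
      (\<forall>\<rho>. range \<rho> \<subseteq> carrier G \<longrightarrow> P (R_map G C \<circ> \<rho>))" for P :: "(nat \<Rightarrow> 'a set \<Rightarrow> 'a set) \<Rightarrow> bool"
  proof (intro iffI allI impI)
    fix \<sigma> :: "nat \<Rightarrow> 'a set \<Rightarrow> 'a set" assume P: "\<forall>\<rho>. range \<rho> \<subseteq> carrier G \<longrightarrow> P (R_map G C \<circ> \<rho>)"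
      and s: "range \<sigma> \<subseteq> R_map G C ` carrier G"
    have "\<forall>n. \<exists>a. a \<in> carrier G \<and> \<sigma> n = R_map G C a" using s by blast
    then obtain \<rho> where r: "\<And>n. \<rho> n \<in> carrier G \<and> \<sigma> n = R_map G C (\<rho> n)" by metis
    then have "\<sigma> = R_map G C \<circ> \<rho>" "range \<rho> \<subseteq> carrier G" by auto
    then show "P \<sigma>" using P by simp
  next
    fix \<rho> :: "nat \<Rightarrow> 'a" assume P: "\<forall>\<sigma>. range \<sigma> \<subseteq> R_map G C ` carrier G \<longrightarrow> P \<sigma>" and "range \<rho> \<subseteq> carrier G"
    then have "range (R_map G C \<circ> \<rho>) \<subseteq> R_map G C ` carrier G" by auto
    with P show "P (R_map G C \<circ> \<rho>)" by blast
  qed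
  have "in_variety (H_lgroup G C) V \<longleftrightarrow> (\<forall>(s, t)\<in>V. \<forall>\<rho>. range \<rho> \<subseteq> carrier G \<longrightarrow>
      R_map G C (gval G (beta G C) \<rho> s) = R_map G C (gval G (beta G C) \<rho> t))"
    unfolding in_variety_def carrier_H lift
    using E.lgroup_K by (simp add: lterm_val_H cong: imp_cong)
  also have "\<dots> \<longleftrightarrow> satisfies G (beta G C) V"
    unfolding satisfies_def by (simp add: eq gval_closed cong: imp_cong)
  finally show ?thesis .
qed

end

end

definition normal_cone :: "'a ogroup \<Rightarrow> (lterm \<times> lterm) set \<Rightarrow> 'a set \<Rightarrow> bool" where
  "normal_cone G V B \<longleftrightarrow> total_submonoid G B \<and>
     (\<forall>a\<in>B. \<forall>t\<in>carrier G. t \<otimes>\<^bsub>G\<^esub> a \<otimes>\<^bsub>G\<^esub> inv\<^bsub>G\<^esub> t \<in> B) \<and>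
     {a \<in> carrier G. \<one>\<^bsub>G\<^esub> \<preceq>\<^bsub>G\<^esub> a} \<subseteq> B \<and> satisfies G B V"

subsection \<open>Failure of an equation is finitely witnessed\<close>

text \<open>With the assignment fixed, evaluating a term asks one membership question in B per join
  or meet. The set \<open>E\<close> collects the elements asked about; for a join or meet this is
  the quotient \<open>?x\<close> of the values of the two arguments.\<close>

lemma gval_finitary:
  "\<exists>E c. finite E \<and> (\<forall>B'. B' \<inter> E = B \<inter> E \<longrightarrow> gval G B' \<rho> s = c)"
proof (induction s)
  case (Inv s)
  then obtain E c where "finite E" "\<And>B'. B' \<inter> E = B \<inter> E \<Longrightarrow> gval G B' \<rho> s = c" by blast
  then show ?case by (intro exI[of _ E] exI[of _ "inv\<^bsub>G\<^esub> c"]) simp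
next
  case (Mult s t)
  obtain E c where E: "finite E" "\<And>B'. B' \<inter> E = B \<inter> E \<Longrightarrow> gval G B' \<rho> s = c"
    using Mult.IH(1) by blast
  obtain E' c' where E': "finite E'" "\<And>B'. B' \<inter> E' = B \<inter> E' \<Longrightarrow> gval G B' \<rho> t = c'"
    using Mult.IH(2) by blast
  have val: "gval G B' \<rho> (Mult s t) = c \<otimes>\<^bsub>G\<^esub> c'" if "B' \<inter> (E \<union> E') = B \<inter> (E \<union> E')" for B'
  proof -
    have "B' \<inter> E = B \<inter> E" "B' \<inter> E' = B \<inter> E'" using that by blast+
    then show ?thesis using E(2)[of B'] E'(2)[of B'] by simp
  qed
  have "finite (E \<union> E')" using E(1) E'(1) by simp
  with val show ?case by (intro exI[of _ "E \<union> E'"] exI[of _ "c \<otimes>\<^bsub>G\<^esub> c'"] conjI allI impI)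
next
  case (Join s t)
  obtain E c where E: "finite E" "\<And>B'. B' \<inter> E = B \<inter> E \<Longrightarrow> gval G B' \<rho> s = c"
    using Join.IH(1) by blast
  obtain E' c' where E': "finite E'" "\<And>B'. B' \<inter> E' = B \<inter> E' \<Longrightarrow> gval G B' \<rho> t = c'"
    using Join.IH(2) by blast
  let ?x = "c' \<otimes>\<^bsub>G\<^esub> inv\<^bsub>G\<^esub> c"
  let ?F = "insert ?x (E \<union> E')"
  have val: "gval G B' \<rho> (Join s t) = (if ?x \<in> B then c' else c)" if "B' \<inter> ?F = B \<inter> ?F" for B'
  proof -
    have "B' \<inter> E = B \<inter> E" "B' \<inter> E' = B \<inter> E'" "?x \<in> B' \<longleftrightarrow> ?x \<in> B" using that by blast+
    then show ?thesis using E(2)[of B'] E'(2)[of B'] by simp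
  qed
  have "finite ?F" using E(1) E'(1) by simp
  with val show ?case
    by (intro exI[of _ ?F] exI[of _ "if ?x \<in> B then c' else c"] conjI allI impI)
next
  case (Meet s t)
  obtain E c where E: "finite E" "\<And>B'. B' \<inter> E = B \<inter> E \<Longrightarrow> gval G B' \<rho> s = c"
    using Meet.IH(1) by blast
  obtain E' c' where E': "finite E'" "\<And>B'. B' \<inter> E' = B \<inter> E' \<Longrightarrow> gval G B' \<rho> t = c'"
    using Meet.IH(2) by blast
  let ?x = "c' \<otimes>\<^bsub>G\<^esub> inv\<^bsub>G\<^esub> c"
  let ?F = "insert ?x (E \<union> E')"
  have val: "gval G B' \<rho> (Meet s t) = (if ?x \<in> B then c else c')" if "B' \<inter> ?F = B \<inter> ?F" for B'
  proof -
    have "B' \<inter> E = B \<inter> E" "B' \<inter> E' = B \<inter> E'" "?x \<in> B' \<longleftrightarrow> ?x \<in> B" using that by blast+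
    then show ?thesis using E(2)[of B'] E'(2)[of B'] by simp
  qed
  have "finite ?F" using E(1) E'(1) by simp
  with val show ?case
    by (intro exI[of _ ?F] exI[of _ "if ?x \<in> B then c else c'"] conjI allI impI)
qed auto

lemma satisfies_iff: "satisfies G B V \<longleftrightarrow> (\<forall>s t \<rho>. (s, t) \<in> V \<longrightarrow> range \<rho> \<subseteq> carrier G \<longrightarrow>
     gval G B \<rho> s \<otimes>\<^bsub>G\<^esub> inv\<^bsub>G\<^esub> (gval G B \<rho> t) \<in> B \<and> gval G B \<rho> t \<otimes>\<^bsub>G\<^esub> inv\<^bsub>G\<^esub> (gval G B \<rho> s) \<in> B)"
  by (auto simp: satisfies_def)

text \<open>\<open>V\<close> may be infinite, but a failure concerns one equation and one
  assignment. Besides the elements inspected while evaluating the two sides, only their two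
  quotients matter.\<close>

lemma satisfies_finitary:
  fixes G (structure)
  assumes "\<not> satisfies G B V"
  shows "\<exists>E. finite E \<and> (\<forall>B'. B' \<inter> E = B \<inter> E \<longrightarrow> \<not> satisfies G B' V)"
proof -
  obtain s t \<rho> where st: "(s, t) \<in> V" "range \<rho> \<subseteq> carrier G"
    and n: "gval G B \<rho> s \<otimes> inv (gval G B \<rho> t) \<notin> B \<or> gval G B \<rho> t \<otimes> inv (gval G B \<rho> s) \<notin> B"
    using assms unfolding satisfies_iff by blast
  obtain E c where E: "finite E" "\<And>B'. B' \<inter> E = B \<inter> E \<Longrightarrow> gval G B' \<rho> s = c"
    using gval_finitary[of B G \<rho> s] by blast
  obtain E' c' where E': "finite E'" "\<And>B'. B' \<inter> E' = B \<inter> E' \<Longrightarrow> gval G B' \<rho> t = c'"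
    using gval_finitary[of B G \<rho> t] by blast
  let ?x = "c \<otimes> inv c'"
  let ?y = "c' \<otimes> inv c"
  have val: "\<not> satisfies G B' V"
    if "B' \<inter> ({?x, ?y} \<union> E \<union> E') = B \<inter> ({?x, ?y} \<union> E \<union> E')" for B'
  proof -
    have "B' \<inter> E = B \<inter> E" "B' \<inter> E' = B \<inter> E'" "?x \<in> B' \<longleftrightarrow> ?x \<in> B" "?y \<in> B' \<longleftrightarrow> ?y \<in> B"
      using that by blast+
    then have "gval G B' \<rho> s \<otimes> inv (gval G B' \<rho> t) \<notin> B' \<or>
        gval G B' \<rho> t \<otimes> inv (gval G B' \<rho> s) \<notin> B'"
      using n E(2)[of B'] E'(2)[of B'] E(2)[of B] E'(2)[of B] by simp
    then show ?thesis using st unfolding satisfies_iff by blast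
  qed
  have "finite ({?x, ?y} \<union> E \<union> E')" using E E' by simp
  with val show ?thesis by (intro exI[of _ "{?x, ?y} \<union> E \<union> E'"] conjI allI impI)
qed

text \<open>If on every finite set B agrees with some normal cone, then each clause holds for B:
  compare B with a normal cone that agrees with it on the elements which that instance of the clause
  mentions. This says that normal cones are closed in the Cantor cube.\<close>

lemma normal_cone_finitary:
  fixes G (structure)
  assumes "group G" and n: "\<not> normal_cone G V B"
  shows "\<exists>E. finite E \<and> (\<forall>B'. B' \<inter> E = B \<inter> E \<longrightarrow> \<not> normal_cone G V B')"
proof -
  have iff: "normal_cone G V B \<longleftrightarrow> (\<forall>x. x \<in> B \<longrightarrow> x \<in> carrier G) \<and> \<one> \<in> B \<and>
      (\<forall>a b. a \<in> B \<longrightarrow> b \<in> B \<longrightarrow> a \<otimes> b \<in> B) \<and>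
      (\<forall>a\<in>carrier G. a \<in> B \<or> inv a \<in> B) \<and>
      (\<forall>a. \<forall>t\<in>carrier G. a \<in> B \<longrightarrow> t \<otimes> a \<otimes> inv t \<in> B) \<and>
      (\<forall>a\<in>carrier G. \<one> \<preceq> a \<longrightarrow> a \<in> B) \<and> satisfies G B V" for B
    unfolding normal_cone_def total_submonoid_def total_submonoid_axioms_def
    by (simp add: assms(1) subset_iff Ball_def imp_conjL cong: conj_cong)
  show ?thesis
  proof (rule ccontr)
    assume "\<not> ?thesis"
    then have fin: "\<exists>B'. B' \<inter> E = B \<inter> E \<and> normal_cone G V B'" if "finite E" for E
      using that by blast
    have "normal_cone G V B"
      unfolding iff
    proof (intro conjI allI ballI impI)
      fix x assume "x \<in> B"
      moreover obtain B' where "B' \<inter> {x} = B \<inter> {x}" "normal_cone G V B'" using fin[of "{x}"] by auto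
      ultimately show "x \<in> carrier G" unfolding iff by blast
    next
      obtain B' where "B' \<inter> {\<one>} = B \<inter> {\<one>}" "normal_cone G V B'" using fin[of "{\<one>}"] by auto
      then show "\<one> \<in> B" unfolding iff by blast
    next
      fix a b assume ab: "a \<in> B" "b \<in> B"
      obtain B' where B': "B' \<inter> {a, b, a \<otimes> b} = B \<inter> {a, b, a \<otimes> b}" and n: "normal_cone G V B'"
        using fin[of "{a, b, a \<otimes> b}"] by auto
      have "a \<in> B'" "b \<in> B'" using ab B' by blast+
      then have "a \<otimes> b \<in> B'" using n unfolding iff by blast
      then show "a \<otimes> b \<in> B" using B' by blast
    next
      fix a assume a: "a \<in> carrier G"
      obtain B' where B': "B' \<inter> {a, inv a} = B \<inter> {a, inv a}" and n: "normal_cone G V B'"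
        using fin[of "{a, inv a}"] by auto
      have "a \<in> B' \<or> inv a \<in> B'" using n a unfolding iff by blast
      then show "a \<in> B \<or> inv a \<in> B" using B' by blast
    next
      fix a t assume t: "t \<in> carrier G" and a: "a \<in> B"
      let ?x = "t \<otimes> a \<otimes> inv t"
      obtain B' where B': "B' \<inter> {a, ?x} = B \<inter> {a, ?x}" and n: "normal_cone G V B'"
        using fin[of "{a, ?x}"] by auto
      have "a \<in> B'" using a B' by blast
      then have "?x \<in> B'" using n t unfolding iff by blast
      then show "?x \<in> B" using B' by blast
    next
      fix a assume a: "a \<in> carrier G" "\<one> \<preceq> a"
      obtain B' where B': "B' \<inter> {a} = B \<inter> {a}" and n: "normal_cone G V B'"
        using fin[of "{a}"] by auto
      have "a \<in> B'" using n a unfolding iff by blast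
      then show "a \<in> B" using B' by blast
    next
      show "satisfies G B V"
      proof (rule ccontr)
        assume "\<not> satisfies G B V"
        then obtain E where "finite E" "\<And>B'. B' \<inter> E = B \<inter> E \<Longrightarrow> \<not> satisfies G B' V"
          using satisfies_finitary[of G B V] by blast
        moreover from this obtain B' where "B' \<inter> E = B \<inter> E" "normal_cone G V B'"
          using fin[of E] by auto
        ultimately show False by (simp add: normal_cone_def)
      qed
    qed
    with n show False by simp
  qed
qed

subsection \<open>Pre-cones and normal cones\<close>

lemma precone_iff_total_submonoid:
  fixes G :: "'a ogroup" (structure)
  assumes "po_group G"
  shows "(\<exists>r. right_preorder G r \<and> C = precone G r) \<longleftrightarrow>
    total_submonoid G C \<and> C \<noteq> carrier G \<and> {a \<in> carrier G. \<one> \<preceq> a} \<subseteq> C"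
proof -
  interpret po_group G by fact
  have "carrier G = C \<union> m_inv G ` C \<longleftrightarrow> (\<forall>a\<in>carrier G. a \<in> C \<or> inv a \<in> C)"
    if C: "C \<subseteq> carrier G"
  proof
    assume h: "carrier G = C \<union> m_inv G ` C"
    show "\<forall>a\<in>carrier G. a \<in> C \<or> inv a \<in> C"
    proof
      fix a assume "a \<in> carrier G"
      then have "a \<in> C \<union> m_inv G ` C" using h by simp
      then show "a \<in> C \<or> inv a \<in> C" using C by auto
    qed
  next
    assume h: "\<forall>a\<in>carrier G. a \<in> C \<or> inv a \<in> C"
    have "a \<in> C \<union> m_inv G ` C" if "a \<in> carrier G" for a
      using h that by (metis UnCI image_eqI inv_inv)
    then show "carrier G = C \<union> m_inv G ` C" using C by auto
  qed
  then show ?thesis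
    unfolding precone_iff[OF assms] total_submonoid_def total_submonoid_axioms_def
    using is_group by blast
qed

lemma preorder_precone_iff:
  fixes G :: "'a ogroup" (structure)
  assumes "po_group G"
  shows "(\<exists>r. preorder G r \<and> C = precone G r) \<longleftrightarrow> (\<exists>r. right_preorder G r \<and> C = precone G r) \<and>
    (\<forall>a\<in>C. \<forall>t\<in>carrier G. t \<otimes> a \<otimes> inv t \<in> C)"
proof (intro iffI conjI; (elim exE conjE)?)
  interpret po_group G by fact
  fix r assume r: "preorder G r" and C: "C = precone G r"
  show "\<exists>r. right_preorder G r \<and> C = precone G r" using r C unfolding preorder_def by blast
  have right: "(a \<otimes> t, b \<otimes> t) \<in> r" if "(a, b) \<in> r" "t \<in> carrier G" for a b t
    using r that unfolding preorder_def right_preorder_def by blast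
  have left: "(t \<otimes> a, t \<otimes> b) \<in> r" if "(a, b) \<in> r" "t \<in> carrier G" for a b t
    using r that unfolding preorder_def by blast
  show "\<forall>a\<in>C. \<forall>t\<in>carrier G. t \<otimes> a \<otimes> inv t \<in> C"
  proof (intro ballI)
    fix a t assume a: "a \<in> C" and t: "t \<in> carrier G"
    then have "(\<one>, a) \<in> r" "a \<in> carrier G" by (simp_all add: C precone_def)
    then have "(t \<otimes> \<one> \<otimes> inv t, t \<otimes> a \<otimes> inv t) \<in> r" using t by (intro right left) auto
    then show "t \<otimes> a \<otimes> inv t \<in> C" using t \<open>a \<in> carrier G\<close> by (simp add: C precone_def)
  qed
next
  interpret po_group G by fact
  fix r assume conj: "\<forall>a\<in>C. \<forall>t\<in>carrier G. t \<otimes> a \<otimes> inv t \<in> C"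
    and r: "right_preorder G r" and C: "C = precone G r"
  have rel: "precone_rel G C = r" unfolding C by (rule precone_rel_precone[OF is_group r])
  have "(t \<otimes> a, t \<otimes> b) \<in> r" if ab: "(a, b) \<in> r" and t: "t \<in> carrier G" for a b t
  proof -
    have cl: "a \<in> carrier G" "b \<in> carrier G" and "b \<otimes> inv a \<in> C"
      using ab unfolding rel[symmetric] precone_rel_def by auto
    then have "t \<otimes> (b \<otimes> inv a) \<otimes> inv t \<in> C" using conj t by blast
    then have "(t \<otimes> b) \<otimes> inv (t \<otimes> a) \<in> C" using cl t by (simp add: inv_mult_group m_assoc)
    then show ?thesis using cl t unfolding rel[symmetric] precone_rel_def by simp
  qed
  then have "preorder G r" using r unfolding preorder_def by blast
  then show "\<exists>r. preorder G r \<and> C = precone G r" using C by blast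
qed

lemma (in total_submonoid) beta_eq_self:
  assumes "\<And>a t. \<lbrakk>a \<in> C; t \<in> carrier G\<rbrakk> \<Longrightarrow> t \<otimes> a \<otimes> inv t \<in> C"
  shows "beta G C = C"
  using assms C_sub mem_beta beta_sub by blast

locale po_group_variety = po_group G for G :: "'a ogroup" (structure) +
  fixes V
  assumes representable: "representable_variety V"
begin

text \<open>The core is closed under conjugation by construction and contains the positive elements
  because the order of G is invariant. Its totality comes from representability in one direction and
  is part of \<open>normal_cone\<close> in the other; given totality, H_C in \<open>V\<close> means
  \<open>satisfies\<close>.\<close>

lemma PV_iff: "C \<in> PV V G \<longleftrightarrow> total_submonoid G C \<and> C \<noteq> carrier G \<and>
    {a \<in> carrier G. \<one> \<preceq> a} \<subseteq> C \<and> normal_cone G V (beta G C)"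
proof -
  have "in_variety (H_lgroup G C) V \<longleftrightarrow> normal_cone G V (beta G C)"
    if C: "total_submonoid G C" and pos: "{a \<in> carrier G. \<one> \<preceq> a} \<subseteq> C"
  proof -
    interpret total_submonoid G C by fact
    have "{a \<in> carrier G. \<one> \<preceq> a} \<subseteq> beta G C"
    proof clarify
      fix a assume a: "a \<in> carrier G" "\<one> \<preceq> a"
      have "t \<otimes> a \<otimes> inv t \<in> C" if "t \<in> carrier G" for t
        using translation_invariant[of \<one> a t "inv t"] a that pos by auto
      then show "a \<in> beta G C" using a by (simp add: mem_beta)
    qed
    moreover have "total_submonoid G (beta G C)" if "in_variety (H_lgroup G C) V"
      using total_submonoid_beta beta_total[OF representable that] by blast
    moreover have "in_variety (H_lgroup G C) V \<longleftrightarrow> satisfies G (beta G C) V"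
      if "total_submonoid G (beta G C)"
      using in_variety_H_iff total_submonoid.C_total[OF that] by blast
    ultimately show ?thesis
      unfolding normal_cone_def using beta_conj by blast
  qed
  then show ?thesis
    unfolding PV_def using precone_iff_total_submonoid[OF po_group_axioms] by blast
qed

lemma BV_iff_PV: "B \<in> BV V G \<longleftrightarrow>
    B \<in> PV V G \<and> (\<forall>a\<in>B. \<forall>t\<in>carrier G. t \<otimes> a \<otimes> inv t \<in> B)"
  unfolding BV_def mem_Collect_eq preorder_precone_iff[OF po_group_axioms] by (auto simp: PV_def)

lemma beta_BV_eq:
  assumes "B \<in> BV V G"
  shows "beta G B = B"
proof -
  interpret total_submonoid G B using assms by (simp add: BV_iff_PV PV_iff)
  show ?thesis using assms by (intro beta_eq_self) (simp add: BV_iff_PV)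
qed

text \<open>A conjugation-closed pre-cone is its own core, so the condition on the core becomes one
  on B itself.\<close>

lemma BV_iff: "B \<in> BV V G \<longleftrightarrow> normal_cone G V B \<and> B \<noteq> carrier G"
proof
  assume B: "B \<in> BV V G"
  then show "normal_cone G V B \<and> B \<noteq> carrier G"
    using beta_BV_eq[OF B] by (auto simp: BV_iff_PV PV_iff)
next
  assume B: "normal_cone G V B \<and> B \<noteq> carrier G"
  then interpret total_submonoid G B by (simp add: normal_cone_def)
  have "beta G B = B" using B by (intro beta_eq_self) (simp add: normal_cone_def)
  then show "B \<in> BV V G"
    using B unfolding BV_iff_PV PV_iff by (auto simp: normal_cone_def)
qed

lemma PV_sub: "C \<in> PV V G \<Longrightarrow> C \<subseteq> carrier G"
  unfolding PV_iff by (blast dest: total_submonoid.C_sub)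

lemma PV_total: "\<lbrakk>C \<in> PV V G; a \<in> carrier G\<rbrakk> \<Longrightarrow> a \<in> C \<or> inv a \<in> C"
  unfolding PV_iff by (blast dest: total_submonoid.C_total)

lemma BV_subset_PV: "BV V G \<subseteq> PV V G"
  by (auto simp: BV_def)

lemma beta_subset: "C \<in> PV V G \<Longrightarrow> beta G C \<subseteq> C"
  unfolding PV_iff by (blast dest: total_submonoid.beta_sub)

text \<open>Membership of H_C in \<open>V\<close> depends on C only through its core, which is a
  normal cone; the core is proper because it lies inside the proper set C.\<close>

lemma beta_BV:
  assumes "C \<in> PV V G"
  shows "beta G C \<in> BV V G"
  using assms beta_subset[OF assms] PV_sub[OF assms] unfolding BV_iff by (auto simp: PV_iff)

lemma beta_mono:
  assumes "C \<subseteq> C'" "C' \<subseteq> carrier G"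
  shows "beta G C \<subseteq> beta G C'"
proof
  fix x assume "x \<in> beta G C"
  moreover have "C \<subseteq> carrier G" using assms by (rule subset_trans)
  ultimately have "x \<in> carrier G \<and> (\<forall>t\<in>carrier G. t \<otimes> x \<otimes> inv t \<in> C)"
    using mem_beta_iff[OF is_group] by blast
  then have "x \<in> carrier G \<and> (\<forall>t\<in>carrier G. t \<otimes> x \<otimes> inv t \<in> C')" using assms(1) by blast
  then show "x \<in> beta G C'" using mem_beta_iff[OF is_group assms(2)] by blast
qed

lemma interior_operator_beta: "interior_operator_on (PV V G) (beta G)"
  unfolding interior_operator_on_def
proof (intro conjI ballI mono_onI)
  show "beta G \<in> PV V G \<rightarrow> PV V G" using beta_BV BV_subset_PV by blast
  show "beta G C \<subseteq> beta G D" if "C \<in> PV V G" "D \<in> PV V G" "C \<subseteq> D" for C D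
    using that PV_sub by (intro beta_mono)
qed (use beta_subset beta_BV beta_BV_eq in simp_all)

lemma BV_eq_open_elements: "BV V G = open_elements (PV V G) (beta G)"
  unfolding open_elements_def using beta_BV beta_BV_eq BV_subset_PV by force

end

subsection \<open>The spectral topology\<close>

lemma openin_cylinder:
  assumes "finite E"
  shows "openin (product_topology (\<lambda>_. discrete_topology UNIV) UNIV) {p. \<forall>x\<in>E. p x = q x}"
    (is "openin ?T _")
proof -
  have "openin ?T {p. p x = q x}" for x
  proof -
    have "openin ?T {p \<in> topspace ?T. p x \<in> {q x}}"
      by (rule openin_continuous_map_preimage[OF continuous_map_product_projection]) auto
    then show ?thesis by simp
  qed
  \<comment> \<open>The factor \<open>topspace ?T\<close> covers the case of empty
    \<open>E\<close>.\<close>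
  then have "openin ?T (topspace ?T \<inter> (\<Inter>x\<in>E. {p. p x = q x}))"
    using assms by (intro openin_Int_Inter openin_topspace) auto
  moreover have "{p. \<forall>x\<in>E. p x = q x} = topspace ?T \<inter> (\<Inter>x\<in>E. {p. p x = q x})" by auto
  ultimately show ?thesis by simp
qed

text \<open>Otherwise S would be the union of its closed subsets S - U and S - W, both
  proper.\<close>

lemma irreducible_closedin_Int:
  assumes S: "irreducible_closedin X S" and "openin X U" "openin X W" and "S \<inter> U \<noteq> {}" "S \<inter> W \<noteq> {}"
  shows "S \<inter> (U \<inter> W) \<noteq> {}"
proof
  assume "S \<inter> (U \<inter> W) = {}"
  then have "S = (S - U) \<union> (S - W)" by blast
  moreover have "closedin X (S - U)" "closedin X (S - W)"
    using assms by (auto simp: irreducible_closedin_def intro: closedin_diff)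
  ultimately have "S = S - U \<or> S = S - W" using S unfolding irreducible_closedin_def by blast
  then show False using assms(4,5) by blast
qed

section \<open>Compact open sets, soberness and continuity\<close>

context po_group_variety
begin

text \<open>For finite nonempty \<open>F\<close> inside G these sets form the base of compact open
  sets; nonemptiness rules out the improper cone.\<close>

definition avoiding :: "'a set \<Rightarrow> 'a set set" where
  "avoiding F = {B \<in> BV V G. B \<inter> F = {}}"

lemma topspace_PV [simp]: "topspace (PV_topology V G) = PV V G"
  by (auto simp: PV_topology_def)

lemma topspace_BV [simp]: "topspace (BV_topology V G) = BV V G"
  using BV_subset_PV by (auto simp: BV_topology_def)

text \<open>By totality a \<notin> C already forces a^-1 \<in> C, so this is the subbasic set
  belonging to a^-1.\<close>

lemma openin_PV_not_mem:
  assumes a: "a \<in> carrier G"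
  shows "openin (PV_topology V G) {C \<in> PV V G. a \<notin> C}"
proof -
  have "{C \<in> PV V G. a \<notin> C} = {C \<in> PV V G. inv a \<in> C \<and> inv (inv a) \<notin> C}"
    using a PV_total by auto
  also have "openin (PV_topology V G) \<dots>"
    unfolding PV_topology_def
    by (rule topology_generated_by_Basis) (use a inv_closed[OF a] in blast)
  finally show ?thesis .
qed

text \<open>Each subbasic condition is the avoidance of one element, and intersections add up the
  avoided sets. \<open>F\<close> can be kept nonempty even for the whole space: C is proper, so some
  element of G lies outside it.\<close>

lemma PV_nbhd:
  assumes "openin (PV_topology V G) U" "C \<in> U"
  shows "\<exists>F. finite F \<and> F \<noteq> {} \<and> F \<subseteq> carrier G \<and> C \<inter> F = {} \<and> {D \<in> PV V G. D \<inter> F = {}} \<subseteq> U"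
proof -
  have "generate_topology_on (insert (PV V G) {{C \<in> PV V G. a \<in> C \<and> inv a \<notin> C} | a. a \<in> carrier G}) U"
    using assms(1) unfolding PV_topology_def by (rule openin_topology_generated_by)
  then show ?thesis using assms(2)
  proof (induction arbitrary: C)
    case (Int U W)
    obtain F where F: "finite F" "F \<noteq> {}" "F \<subseteq> carrier G" "C \<inter> F = {}"
      "{D \<in> PV V G. D \<inter> F = {}} \<subseteq> U" using Int.IH(1)[of C] Int.prems by blast
    obtain F' where F': "finite F'" "F' \<subseteq> carrier G" "C \<inter> F' = {}"
      "{D \<in> PV V G. D \<inter> F' = {}} \<subseteq> W" using Int.IH(2)[of C] Int.prems by blast
    have "finite (F \<union> F')" using F F' by simp
    then show ?case using F F' by (intro exI[of _ "F \<union> F'"]) blast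
  next
    case (UN K)
    then obtain U where U: "U \<in> K" "C \<in> U" by blast
    obtain F where F: "finite F" "F \<noteq> {}" "F \<subseteq> carrier G" "C \<inter> F = {}"
      and "{D \<in> PV V G. D \<inter> F = {}} \<subseteq> U" using UN.IH[OF U] by blast
    then have "{D \<in> PV V G. D \<inter> F = {}} \<subseteq> \<Union>K" using U(1) by (intro order_trans[OF _ Union_upper])
    with F show ?case by blast
  next
    case (Basis s)
    then consider "s = PV V G"
      | a where "a \<in> carrier G" "s = {C \<in> PV V G. a \<in> C \<and> inv a \<notin> C}" by blast
    then show ?case
    proof cases
      case 1
      then have "C \<subseteq> carrier G" "C \<noteq> carrier G" using Basis PV_sub by (auto simp: PV_iff)
      then obtain a where "a \<in> carrier G" "a \<notin> C" by blast
      then show ?thesis using 1 by (intro exI[of _ "{a}"]) blast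
    next
      case 2
      then show ?thesis using Basis PV_total by (intro exI[of _ "{inv a}"]) auto
    qed
  qed simp
qed

lemma openin_avoiding:
  assumes "finite F" "F \<subseteq> carrier G"
  shows "openin (BV_topology V G) (avoiding F)"
proof -
  have "openin (BV_topology V G) {B \<in> BV V G. a \<notin> B}" if "a \<in> carrier G" for a
    unfolding BV_topology_def openin_subtopology
    using openin_PV_not_mem[OF that] BV_subset_PV by (intro exI[of _ "{C \<in> PV V G. a \<notin> C}"]) blast
  then have "openin (BV_topology V G) (topspace (BV_topology V G) \<inter> (\<Inter>a\<in>F. {B \<in> BV V G. a \<notin> B}))"
    using assms by (intro openin_Int_Inter openin_topspace) auto
  moreover have "avoiding F = topspace (BV_topology V G) \<inter> (\<Inter>a\<in>F. {B \<in> BV V G. a \<notin> B})"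
    by (auto simp: avoiding_def)
  ultimately show ?thesis by simp
qed

lemma BV_nbhd:
  assumes "openin (BV_topology V G) U" "B \<in> U"
  shows "\<exists>F. finite F \<and> F \<noteq> {} \<and> F \<subseteq> carrier G \<and> B \<in> avoiding F \<and> avoiding F \<subseteq> U"
proof -
  obtain W where W: "openin (PV_topology V G) W" "U = W \<inter> BV V G"
    using assms(1) unfolding BV_topology_def openin_subtopology by blast
  obtain F where "finite F" "F \<noteq> {}" "F \<subseteq> carrier G" "B \<inter> F = {}" "{D \<in> PV V G. D \<inter> F = {}} \<subseteq> W"
    using PV_nbhd[OF W(1), of B] assms(2) W(2) by blast
  then show ?thesis
    using W(2) assms(2) BV_subset_PV unfolding avoiding_def by (intro exI[of _ F]) blast
qed

text \<open>A point outside the set either meets \<open>F\<close> or fails to be a normal cone. Both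
  are visible on finitely many coordinates, so a cylinder around the point stays outside.\<close>

lemma closedin_normal_cones:
  assumes "finite F"
  shows "closedin (product_topology (\<lambda>_. discrete_topology UNIV) UNIV)
    {p. normal_cone G V (Collect p) \<and> Collect p \<inter> F = {}}" (is "closedin ?T ?K")
proof -
  have "\<exists>N. openin ?T N \<and> q \<in> N \<and> N \<subseteq> - ?K" if q: "q \<in> - ?K" for q
  proof -
    have "\<exists>E. finite E \<and> (\<forall>p. (\<forall>x\<in>E. p x = q x) \<longrightarrow> p \<notin> ?K)"
    proof (cases "normal_cone G V (Collect q)")
      case True
      then show ?thesis using q assms by (intro exI[of _ F]) auto
    next
      case False
      then obtain E where E: "finite E" "\<And>B'. B' \<inter> E = Collect q \<inter> E \<Longrightarrow> \<not> normal_cone G V B'"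
        using normal_cone_finitary[OF is_group, of V "Collect q"] by blast
      have "p \<notin> ?K" if "\<forall>x\<in>E. p x = q x" for p
      proof -
        have "Collect p \<inter> E = Collect q \<inter> E" using that by auto
        then show ?thesis using E(2) by simp
      qed
      then show ?thesis using E(1) by blast
    qed
    then obtain E where E: "finite E" "\<And>p. (\<forall>x\<in>E. p x = q x) \<Longrightarrow> p \<notin> ?K" by blast
    then show ?thesis
      using openin_cylinder[OF E(1), of q] by (intro exI[of _ "{p. \<forall>x\<in>E. p x = q x}"]) blast
  qed
  then have "openin ?T (- ?K)" by (subst openin_subopen) blast
  then show ?thesis by (simp add: closedin_def Compl_eq_Diff_UNIV)
qed

text \<open>Passing from characteristic functions to sets is continuous on the closed, hence
  compact, set \<open>?K\<close>, and it maps \<open>?K\<close> onto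
  \<open>avoiding F\<close>.\<close>

lemma compactin_avoiding:
  assumes F: "finite F" "F \<noteq> {}" "F \<subseteq> carrier G"
  shows "compactin (BV_topology V G) (avoiding F)"
proof -
  let ?T = "product_topology (\<lambda>_::'a. discrete_topology (UNIV :: bool set)) UNIV"
  let ?K = "{p. normal_cone G V (Collect p) \<and> Collect p \<inter> F = {}}"
  have "compact_space ?T" by (simp add: compact_space_product_topology compact_space_discrete_topology)
  then have K: "compactin ?T ?K" using closedin_normal_cones[OF F(1)] by (rule closedin_compact_space)
  \<comment> \<open>A normal cone missing the nonempty set \<open>F\<close> is proper, hence a
    pre-order.\<close>
  have img: "Collect ` ?K = avoiding F"
  proof -
    have "B \<in> Collect ` ?K" if "B \<in> avoiding F" for B
      using that by (intro image_eqI[of _ _ "\<lambda>x. x \<in> B"]) (auto simp: avoiding_def BV_iff)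
    moreover have "Collect p \<in> avoiding F" if "p \<in> ?K" for p
      using that F by (auto simp: avoiding_def BV_iff)
    ultimately show ?thesis by blast
  qed
  have cont: "continuous_map (subtopology ?T ?K) (BV_topology V G) Collect"
    unfolding continuous_map_def
  proof (intro conjI allI impI)
    show "Collect \<in> topspace (subtopology ?T ?K) \<rightarrow> topspace (BV_topology V G)"
      using img by (auto simp: avoiding_def)
    fix U assume U: "openin (BV_topology V G) U"
    let ?U = "{p \<in> topspace (subtopology ?T ?K). Collect p \<in> U}"
    have "\<exists>N. openin (subtopology ?T ?K) N \<and> q \<in> N \<and> N \<subseteq> ?U" if q: "q \<in> ?U" for q
    proof -
      obtain E where E: "finite E" "Collect q \<in> avoiding E" "avoiding E \<subseteq> U"
        using BV_nbhd[OF U, of "Collect q"] q by blast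
      \<comment> \<open>Agreement with q on \<open>E\<close> makes the set of p miss
        \<open>E\<close>, as that of q does; \<open>?K\<close> provides the rest of membership in
        \<open>avoiding E\<close>.\<close>
      let ?N = "{p. \<forall>x\<in>E. p x = q x} \<inter> ?K"
      have "openin (subtopology ?T ?K) ?N"
        using openin_cylinder[OF E(1), of q] unfolding openin_subtopology by blast
      moreover have "Collect p \<in> U" if "p \<in> ?N" for p
      proof -
        have "Collect p \<in> avoiding F" using that img by blast
        moreover have "Collect p \<inter> E = {}" using that E(2) by (auto simp: avoiding_def)
        ultimately show ?thesis using E(3) by (auto simp: avoiding_def)
      qed
      ultimately show ?thesis using q by (intro exI[of _ ?N]) auto
    qed
    then show "openin (subtopology ?T ?K) ?U" by (subst openin_subopen) blast
  qed
  have "compactin (subtopology ?T ?K) ?K" using K by (simp add: compactin_subtopology)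
  from image_compactin[OF this cont] show ?thesis unfolding img .
qed

lemma compact_opens_BV_iff: "U \<in> compact_opens (BV_topology V G) \<longleftrightarrow>
    (\<exists>\<F>. finite \<F> \<and> (\<forall>F\<in>\<F>. finite F \<and> F \<noteq> {} \<and> F \<subseteq> carrier G) \<and> U = \<Union>(avoiding ` \<F>))"
proof
  assume U: "U \<in> compact_opens (BV_topology V G)"
  let ?A = "{F. finite F \<and> F \<noteq> {} \<and> F \<subseteq> carrier G \<and> avoiding F \<subseteq> U}"
  have o: "openin (BV_topology V G) U" and c: "compactin (BV_topology V G) U"
    using U by (simp_all add: compact_opens_def)
  have "U \<subseteq> \<Union>(avoiding ` ?A)" using BV_nbhd[OF o] by blast
  moreover have "openin (BV_topology V G) W" if "W \<in> avoiding ` ?A" for W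
    using that openin_avoiding by auto
  ultimately obtain \<W> where W: "finite \<W>" "\<W> \<subseteq> avoiding ` ?A" "U \<subseteq> \<Union>\<W>"
    using compactinD[OF c, of "avoiding ` ?A"] by auto
  obtain \<F> where F: "\<F> \<subseteq> ?A" "finite \<F>" and im: "\<W> = avoiding ` \<F>"
    using finite_subset_image[OF W(1,2)] by blast
  have "\<Union>(avoiding ` \<F>) \<subseteq> U" using F(1) by blast
  then have "U = \<Union>(avoiding ` \<F>)" using W(3) unfolding im by (rule subset_antisym[rotated])
  moreover have "\<forall>F\<in>\<F>. finite F \<and> F \<noteq> {} \<and> F \<subseteq> carrier G" using F(1) by blast
  ultimately show "\<exists>\<F>. finite \<F> \<and> (\<forall>F\<in>\<F>. finite F \<and> F \<noteq> {} \<and> F \<subseteq> carrier G) \<and> U = \<Union>(avoiding ` \<F>)"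
    using F(2) by (intro exI[of _ \<F>] conjI)
next
  assume "\<exists>\<F>. finite \<F> \<and> (\<forall>F\<in>\<F>. finite F \<and> F \<noteq> {} \<and> F \<subseteq> carrier G) \<and> U = \<Union>(avoiding ` \<F>)"
  then obtain \<F> where F: "finite \<F>" "\<forall>F\<in>\<F>. finite F \<and> F \<noteq> {} \<and> F \<subseteq> carrier G"
    and U: "U = \<Union>(avoiding ` \<F>)" by blast
  have "compactin (BV_topology V G) U"
    unfolding U using F compactin_avoiding by (intro compactin_Union) auto
  moreover have "openin (BV_topology V G) U"
    unfolding U using F openin_avoiding by blast
  ultimately show "U \<in> compact_opens (BV_topology V G)" by (simp add: compact_opens_def)
qed

lemma compact_opens_BV_Int:
  assumes "U \<in> compact_opens (BV_topology V G)" "W \<in> compact_opens (BV_topology V G)"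
  shows "U \<inter> W \<in> compact_opens (BV_topology V G)"
proof -
  obtain \<F> where F: "finite \<F>" "\<forall>F\<in>\<F>. finite F \<and> F \<noteq> {} \<and> F \<subseteq> carrier G" "U = \<Union>(avoiding ` \<F>)"
    using assms(1) unfolding compact_opens_BV_iff by blast
  obtain \<F>' where F': "finite \<F>'" "\<forall>F\<in>\<F>'. finite F \<and> F \<noteq> {} \<and> F \<subseteq> carrier G" "W = \<Union>(avoiding ` \<F>')"
    using assms(2) unfolding compact_opens_BV_iff by blast
  let ?\<G> = "(\<lambda>(F, F'). F \<union> F') ` (\<F> \<times> \<F>')"
  have "avoiding (F \<union> F') = avoiding F \<inter> avoiding F'" for F F'
    by (auto simp: avoiding_def)
  then have "U \<inter> W = \<Union>(avoiding ` ?\<G>)" unfolding F F' by auto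
  moreover have "finite ?\<G>" "\<forall>F\<in>?\<G>. finite F \<and> F \<noteq> {} \<and> F \<subseteq> carrier G" using F F' by auto
  ultimately show ?thesis unfolding compact_opens_BV_iff by blast
qed

text \<open>Basic open sets are downward closed under inclusion, and an element of B outside D gives
  an open set that contains D but not B. Specialisation is therefore inclusion.\<close>

lemma in_closure_of_BV:
  assumes B: "B \<in> BV V G"
  shows "D \<in> BV_topology V G closure_of {B} \<longleftrightarrow> D \<in> BV V G \<and> B \<subseteq> D"
proof
  assume D: "D \<in> BV_topology V G closure_of {B}"
  then have DB: "D \<in> BV V G" by (simp add: in_closure_of)
  have "a \<in> D" if a: "a \<in> B" for a
  proof (rule ccontr)
    assume "a \<notin> D"
    then have "D \<in> avoiding {a}" using DB by (simp add: avoiding_def)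
    moreover have "openin (BV_topology V G) (avoiding {a})"
      using B a BV_subset_PV PV_sub by (intro openin_avoiding) blast+
    ultimately have "B \<in> avoiding {a}" using D by (auto simp: in_closure_of)
    then show False using a by (simp add: avoiding_def)
  qed
  then show "D \<in> BV V G \<and> B \<subseteq> D" using DB by blast
next
  assume D: "D \<in> BV V G \<and> B \<subseteq> D"
  have "B \<in> U" if DU: "D \<in> U" and U: "openin (BV_topology V G) U" for U
  proof -
    obtain F where "D \<in> avoiding F" "avoiding F \<subseteq> U" using BV_nbhd[OF U DU] by blast
    moreover from this have "B \<in> avoiding F" using B D unfolding avoiding_def by blast
    ultimately show ?thesis by blast
  qed
  then show "D \<in> BV_topology V G closure_of {B}" using D by (auto simp: in_closure_of)
qed

text \<open>Nonempty open traces on an irreducible set intersect, so avoiding each element of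
  \<open>F\<close> by some member of S can be achieved by a single member.\<close>

lemma irreducible_avoid:
  assumes S: "irreducible_closedin (BV_topology V G) S"
    and "finite F" "F \<subseteq> carrier G" "\<And>a. a \<in> F \<Longrightarrow> \<exists>C\<in>S. a \<notin> C"
  shows "\<exists>C\<in>S. C \<inter> F = {}"
proof -
  have SB: "S \<subseteq> BV V G"
    using S closedin_subset[of "BV_topology V G" S] by (simp add: irreducible_closedin_def)
  have "S \<inter> avoiding F \<noteq> {}" using assms(2-4)
  proof (induction F rule: finite_induct)
    case empty
    then show ?case using S SB by (auto simp: irreducible_closedin_def avoiding_def)
  next
    case (insert a F)
    then have "S \<inter> avoiding F \<noteq> {}" by blast
    moreover have "S \<inter> avoiding {a} \<noteq> {}"
      using insert.prems(2)[of a] SB by (auto simp: avoiding_def)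
    ultimately have "S \<inter> (avoiding {a} \<inter> avoiding F) \<noteq> {}"
      using insert by (intro irreducible_closedin_Int[OF S] openin_avoiding) auto
    moreover have "avoiding {a} \<inter> avoiding F = avoiding (insert a F)" by (auto simp: avoiding_def)
    ultimately show ?case by simp
  qed
  then show ?thesis by (auto simp: avoiding_def)
qed

lemma irreducible_generic_point:
  assumes S: "irreducible_closedin (BV_topology V G) S"
  shows "\<Inter>S \<in> BV V G \<and> S = BV_topology V G closure_of {\<Inter>S}"
proof -
  have cl: "closedin (BV_topology V G) S" and ne: "S \<noteq> {}"
    using S by (simp_all add: irreducible_closedin_def)
  have SB: "S \<subseteq> BV V G" using closedin_subset[OF cl] by simp
  obtain C0 where C0: "C0 \<in> S" using ne by blast
  have sub: "C \<subseteq> carrier G" if "C \<in> S" for C using that SB BV_subset_PV PV_sub by blast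
  have "normal_cone G V (\<Inter>S)"
  proof (rule ccontr)
    assume "\<not> normal_cone G V (\<Inter>S)"
    then obtain E where E: "finite E" "\<And>B'. B' \<inter> E = \<Inter>S \<inter> E \<Longrightarrow> \<not> normal_cone G V B'"
      using normal_cone_finitary[OF is_group, of V "\<Inter>S"] by blast
    \<comment> \<open>One member of S avoids all of \<open>E\<close> that lies outside \<Inter>S, so
      it agrees with \<Inter>S on \<open>E\<close>; being a normal cone, it contradicts the choice
      of \<open>E\<close>.\<close>
    obtain C where C: "C \<in> S" "C \<inter> (E \<inter> carrier G - \<Inter>S) = {}"
      using irreducible_avoid[OF S, of "E \<inter> carrier G - \<Inter>S"] E(1) by blast
    then have "C \<inter> E = \<Inter>S \<inter> E" using sub[OF C(1)] by blast
    then show False using E(2) C(1) SB by (auto simp: BV_iff)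
  qed
  moreover have "\<Inter>S \<noteq> carrier G"
  proof -
    have "C0 \<noteq> carrier G" using C0 SB BV_iff by blast
    then show ?thesis using C0 sub[OF C0] by blast
  qed
  ultimately have D: "\<Inter>S \<in> BV V G" by (simp add: BV_iff)
  have "\<Inter>S \<in> S"
  proof (rule ccontr)
    assume "\<Inter>S \<notin> S"
    then have "\<Inter>S \<in> topspace (BV_topology V G) - S" using D by simp
    moreover have "openin (BV_topology V G) (topspace (BV_topology V G) - S)" using cl by blast
    ultimately obtain F where F: "finite F" "F \<subseteq> carrier G" "\<Inter>S \<in> avoiding F"
      "avoiding F \<subseteq> topspace (BV_topology V G) - S" using BV_nbhd by metis
    \<comment> \<open>Every basic neighbourhood of \<Inter>S meets S for the same reason, so the
      closed set S contains \<Inter>S.\<close>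
    have "\<exists>C\<in>S. a \<notin> C" if "a \<in> F" for a using that F(3) by (auto simp: avoiding_def)
    then obtain C where "C \<in> S" "C \<inter> F = {}" using irreducible_avoid[OF S F(1,2)] by blast
    then show False using F(4) SB by (auto simp: avoiding_def)
  qed
  then have "BV_topology V G closure_of {\<Inter>S} \<subseteq> S" using cl by (intro closure_of_minimal) auto
  moreover have "S \<subseteq> BV_topology V G closure_of {\<Inter>S}"
    using SB by (auto simp: in_closure_of_BV[OF D])
  ultimately show ?thesis using D by blast
qed

lemma sober_BV: "sober_space (BV_topology V G)"
  unfolding sober_space_def
proof (intro allI impI)
  fix S assume S: "irreducible_closedin (BV_topology V G) S"
  show "\<exists>!B. B \<in> topspace (BV_topology V G) \<and> S = BV_topology V G closure_of {B}"
  proof (rule ex1I)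
    show "\<Inter>S \<in> topspace (BV_topology V G) \<and> S = BV_topology V G closure_of {\<Inter>S}"
      using irreducible_generic_point[OF S] by simp
    fix B assume "B \<in> topspace (BV_topology V G) \<and> S = BV_topology V G closure_of {B}"
    then have B: "B \<in> BV V G" and "S = BV_topology V G closure_of {B}" by simp_all
    \<comment> \<open>A generic point is the least element of S, which determines it.\<close>
    then have "C \<in> S \<longleftrightarrow> C \<in> BV V G \<and> B \<subseteq> C" for C using in_closure_of_BV by simp
    then show "B = \<Inter>S" using B by blast
  qed
qed

lemma generalised_spectral_BV: "generalised_spectral_space (BV_topology V G)"
  unfolding generalised_spectral_space_def
proof (intro conjI allI impI)
  show "sober_space (BV_topology V G)" by (rule sober_BV)
next
  fix U assume U: "openin (BV_topology V G) U"
  let ?\<U> = "{avoiding F | F. finite F \<and> F \<noteq> {} \<and> F \<subseteq> carrier G \<and> avoiding F \<subseteq> U}"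
  have "?\<U> \<subseteq> compact_opens (BV_topology V G)"
    using openin_avoiding compactin_avoiding by (auto simp: compact_opens_def)
  moreover have "U = \<Union>?\<U>"
  proof (rule subset_antisym)
    show "\<Union>?\<U> \<subseteq> U" by blast
  next
    show "U \<subseteq> \<Union>?\<U>"
    proof
      fix B assume "B \<in> U"
      then obtain F where "finite F \<and> F \<noteq> {} \<and> F \<subseteq> carrier G \<and> avoiding F \<subseteq> U" "B \<in> avoiding F"
        using BV_nbhd[OF U] by blast
      then show "B \<in> \<Union>?\<U>" by blast
    qed
  qed
  ultimately show "\<exists>\<U>\<subseteq>compact_opens (BV_topology V G). U = \<Union>\<U>" by (intro exI[of _ ?\<U>] conjI)
next
  fix \<F> assume "finite \<F> \<and> \<F> \<noteq> {} \<and> \<F> \<subseteq> compact_opens (BV_topology V G)"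
  then have "finite \<F>" "\<F> \<noteq> {}" "\<F> \<subseteq> compact_opens (BV_topology V G)" by blast+
  then show "\<Inter>\<F> \<in> compact_opens (BV_topology V G)"
    by (induction \<F> rule: finite_ne_induct) (auto simp: compact_opens_BV_Int)
qed

lemma continuous_beta: "continuous_map (PV_topology V G) (BV_topology V G) (beta G)"
proof -
  have "continuous_map (PV_topology V G) (PV_topology V G) (beta G)"
    unfolding PV_topology_def[of V G]
  proof (rule continuous_on_generated_topo, fold PV_topology_def)
    fix U assume "U \<in> insert (PV V G) {{C \<in> PV V G. a \<in> C \<and> inv a \<notin> C} | a. a \<in> carrier G}"
    then consider "U = PV V G"
      | a where "a \<in> carrier G" "U = {C \<in> PV V G. a \<in> C \<and> inv a \<notin> C}" by blast
    then show "openin (PV_topology V G) (beta G -` U \<inter> topspace (PV_topology V G))"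
    proof cases
      case 1
      then have "beta G -` U \<inter> topspace (PV_topology V G) = topspace (PV_topology V G)"
        using beta_BV BV_subset_PV by auto
      then show ?thesis by (simp only: openin_topspace)
    next
      case 2
      have "beta G -` U \<inter> topspace (PV_topology V G) = {C \<in> PV V G. inv a \<notin> beta G C}"
        using 2 beta_BV BV_subset_PV PV_total by auto
      \<comment> \<open>An element is missing from the core iff one of its conjugates is missing
        from C, so the preimage is a union of open sets.\<close>
      also have "\<dots> = (\<Union>t\<in>carrier G. {C \<in> PV V G. t \<otimes> inv a \<otimes> inv t \<notin> C})"
        using 2 PV_sub by (auto simp: mem_beta_iff[OF is_group])
      also have "openin (PV_topology V G) \<dots>" using 2 openin_PV_not_mem by auto
      finally show ?thesis .
    qed
  next
    show "beta G ` topspace (PV_topology V G) \<subseteq>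
        \<Union> (insert (PV V G) {{C \<in> PV V G. a \<in> C \<and> inv a \<notin> C} | a. a \<in> carrier G})"
      using beta_BV BV_subset_PV by auto
  qed
  then show ?thesis
    unfolding BV_topology_def using beta_BV by (intro continuous_map_into_subtopology) auto
qed

lemma retraction_beta: "retraction_maps (PV_topology V G) (BV_topology V G) (beta G) id"
  unfolding retraction_maps_def using continuous_beta beta_BV_eq
  by (simp add: BV_topology_def continuous_map_from_subtopology)

end

theorem theorem8p2:
  fixes G :: "'a ogroup" and V :: "(lterm \<times> lterm) set"
  assumes "po_group G" and "representable_variety V"
  shows "generalised_spectral_space (BV_topology V G) \<and>
    interior_operator_on (PV V G) (beta G) \<and>
    BV V G = open_elements (PV V G) (beta G) \<and>
    retraction_maps (PV_topology V G) (BV_topology V G) (beta G) id"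
proof -
  interpret po_group_variety G V
    using assms by (intro po_group_variety.intro po_group_variety_axioms.intro)
  show ?thesis
    using generalised_spectral_BV interior_operator_beta BV_eq_open_elements retraction_beta by blast
qed

end
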